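(* Let $\mathbb{K}$ be a field, $d\ge 0$ an integer, $\mathcal{A}$ a $\mathbb{K}$-algebra isomorphic to $\mathrm{Mat}_{d+1}(\mathbb{K})$, and let $\Phi=(A;\{E_i\}_{i=0}^d;A^*;\{E^*_i\}_{i=0}^d)$ be a Leonard system in $\mathcal{A}$ with first split sequence $\{\varphi_i\}_{i=1}^d$ and second split sequence $\{\phi_i\}_{i=1}^d$. Let $F_k$, $F^*_k$, $F^{\downarrow}_k$, $F^{\Downarrow}_k$ $(0\le k\le d)$ be the idempotents attached to the split decompositions of $\Phi$, $\Phi^*$, $\Phi^{\downarrow}$, $\Phi^{\Downarrow}$ respectively. Then for $1\le i\le d$, $\varphi_i$ is equal to each of $$\sum_{k=i}^{d}\mathrm{tr}((AA^*-A^*A)F_k),\qquad \sum_{k=0}^{i-1}\mathrm{tr}((A^*A-AA^* )F_k),$$ $$\sum_{k=0}^{i-1}\mathrm{tr}((AA^*-A^*A)F^*_k),\qquad \sum_{k=i}^{d}\mathrm{tr}((A^*A-AA^* )F^*_k).$$ Moreover, for $1\le i\le d$, $\phi_i$ is equal to each of $$\sum_{k=d-i+1}^{d}\mathrm{tr}((AA^*-A^*A)F^{\downarrow}_k),\qquad \sum_{k=0}^{d-i}\mathrm{tr}((A^*A-AA^* )F^{\downarrow}_k),$$ $$\sum_{k=i}^{d}\mathrm{tr}((AA^*-A^*A)F^{\Downarrow}_k),\qquad \sum_{k=0}^{i-1}\mathrm{tr}((A^*A-AA^* )F^{\Downarrow}_k).$$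
   Context: Notation: $A^*$ is just the name of an element (not the conjugate-transpose of $A$). $V$ denotes a simple $\mathcal{A}$-module (unique up to isomorphism, of dimension $d+1$ over $\mathbb{K}$); $\mathrm{tr}$ is the trace of the action on $V$. Rows and columns of matrices in $\mathrm{Mat}_{d+1}(\mathbb{K})$ are indexed by $0,1,\dots,d$. Primitive idempotents. An element $A\in\mathcal{A}$ is multiplicity-free if it has $d+1$ mutually distinct eigenvalues in $\mathbb{K}$. If $\theta_0,\dots,\theta_d$ is an ordering of these eigenvalues, the primitive idempotent of $A$ associated with $\theta_i$ is $E_i=\prod_{0\le j\le d,\ j\ne i}\frac{A-\theta_jI}{\theta_i-\theta_j}$. Leonard system. A Leonard system in $\mathcal{A}$ is a sequence $\Phi=(A;\{E_i\}_{i=0}^d;A^*;\{E^*_i\}_{i=0}^d)$ such that: (i) $A,A^*\in\mathcal{A}$ are both multiplicity-free; (ii) $E_0,\dots,E_d$ is an ordering of the primitive idempotents of $A$; (iii) $E^*_0,\dots,E^*_d$ is an ordering of the primitive idempotents of $A^*$; (iv) for $0\le i,j\le d$, $E_iA^*E_j=0$ if $|i-j|>1$ and $E_iA^*E_j\neq0$ if $|i-j|=1$; (v) for $0\le i,j\le d$, $E^*_iAE^*_j=0$ if $|i-j|>1$ and $E^*_iAE^*_j\ne0$ if $|i-j|=1$. Given $\Phi$, the following are also Leonard systems in $\mathcal{A}$: $\Phi^*=(A^*;\{E^*_i\}_{i=0}^d;A;\{E_i\}_{i=0}^d)$, $\Phi^{\downarrow}=(A;\{E_i\}_{i=0}^d;A^*;\{E^*_{d-i}\}_{i=0}^d)$,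 $\Phi^{\Downarrow}=(A;\{E_{d-i}\}_{i=0}^d;A^*;\{E^*_i\}_{i=0}^d)$. Split sequences. $\theta_i$ is the eigenvalue of $A$ associated with $E_i$, and $\theta^*_i$ is the eigenvalue of $A^*$ associated with $E^*_i$. For $0\le i\le d$ put $U_i=(E^*_0V+\cdots+E^*_iV)\cap(E_iV+\cdots+E_dV)$. It is known that each $U_i$ is $1$-dimensional, $V=U_0\oplus\cdots\oplus U_d$ (the $\Phi$-split decomposition), $(A-\theta_iI)U_i=U_{i+1}$ $(0\le i\le d-1)$, $(A-\theta_dI)U_d=0$, $(A^*-\theta^*_iI)U_i=U_{i-1}$ $(1\le i\le d)$, $(A^*-\theta^*_0I)U_0=0$. For $1\le i\le d$, $\varphi_i$ denotes the (nonzero) eigenvalue of $(A-\theta_{i-1}I)(A^*-\theta^*_iI)$ on $U_i$; $\varphi_1,\dots,\varphi_d$ is the first split sequence of $\Phi$. The second split sequence $\phi_1,\dots,\phi_d$ of $\Phi$ is the first split sequence of $\Phi^{\Downarrow}$; that is, $\phi_i$ is the (nonzero) eigenvalue of $(A-\theta_{d-i+1}I)(A^*-\theta^*_iI)$ on $(E^*_0V+\cdots+E^*_iV)\cap(E_{d-i}V+E_{d-i-1}V+\cdots+E_0V)$. Idempotents $F_k$. A $\Phi$-split basis of $V$ is a basis $u_0,\dots,u_d$ with $0\ne u_i\in U_i$ for all $i$ and $(A-\theta_iI)u_i=u_{i+1}$ $(0\le i\le d-1)$; it is unique up to multiplying all $u_i$ by one common nonzero scalar. $F_k\in\mathcal{A}$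 is the element whose matrix with respect to this basis has $(k,k)$-entry $1$ and all other entries $0$; equivalently $F_k$ acts on $V$ as the projection onto $U_k$ that vanishes on $U_j$ for $j\neq k$. $F^*_k$, $F^{\downarrow}_k$, $F^{\Downarrow}_k$ denote the element $F_k$ constructed in the same way from the Leonard systems $\Phi^*$, $\Phi^{\downarrow}$, $\Phi^{\Downarrow}$ in place of $\Phi$, i.e. the projections onto the $k$-th component of the decompositions with components, respectively, $(E_0V+\cdots+E_kV)\cap(E^*_kV+\cdots+E^*_dV)$, $(E^*_dV+\cdots+E^*_{d-k}V)\cap(E_kV+\cdots+E_dV)$, $(E^*_0V+\cdots+E^*_kV)\cap(E_{d-k}V+\cdots+E_0V)$ $(0\le k\le d)$. *)

theory Defs
  imports "Jordan_Normal_Form.Matrix" "HOL-Library.Set_Algebras"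
begin

section \<open>Algebras and simple modules\<close>

locale K_algebra = vector_space sA
  for sA :: "'k::field \<Rightarrow> 'a::ring_1 \<Rightarrow> 'a" +
  assumes scale_mult_left: "sA c x * y = sA c (x * y)"
    and scale_mult_right: "x * sA c y = sA c (x * y)"

locale K_algebra_module = K_algebra sA + V: vector_space sV
  for sA :: "'k::field \<Rightarrow> 'a::ring_1 \<Rightarrow> 'a"
    and sV :: "'k \<Rightarrow> 'v::ab_group_add \<Rightarrow> 'v" +
  fixes act :: "'a \<Rightarrow> 'v \<Rightarrow> 'v"
  assumes act_add_left: "act (x + y) v = act x v + act y v"
    and act_add_right: "act x (v + w) = act x v + act x w"
    and act_mult: "act (x * y) v = act x (act y v)"
    and act_one: "act 1 v = v"
    and act_scale: "act (sA c x) v = sV c (act x v)"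

locale simple_K_algebra_module = K_algebra_module sA sV act
  for sA :: "'k::field \<Rightarrow> 'a::ring_1 \<Rightarrow> 'a"
    and sV :: "'k \<Rightarrow> 'v::ab_group_add \<Rightarrow> 'v"
    and act :: "'a \<Rightarrow> 'v \<Rightarrow> 'v" +
  assumes nonzero: "\<exists>v::'v. v \<noteq> 0"
    and simple: "\<lbrakk>V.subspace W; \<And>x w. w \<in> W \<Longrightarrow> act x w \<in> W\<rbrakk> \<Longrightarrow> W = {0} \<or> W = UNIV"

definition isomorphic_to_Mat :: "nat \<Rightarrow> ('k::field \<Rightarrow> 'a::ring_1 \<Rightarrow> 'a) \<Rightarrow> bool" where
  "isomorphic_to_Mat n sA \<longleftrightarrow>
     (\<exists>f :: 'a \<Rightarrow> 'k mat.
        bij_betw f UNIV (carrier_mat n n) \<and>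
        f 1 = 1\<^sub>m n \<and>
        (\<forall>x y. f (x + y) = f x + f y) \<and>
        (\<forall>x y. f (x * y) = f x * f y) \<and>
        (\<forall>c x. f (sA c x) = c \<cdot>\<^sub>m f x))"

text \<open>The trace is the sum of the diagonal entries of the matrix of the action with respect
  to a basis of \<open>V\<close>; on a finite-dimensional \<open>V\<close> the choice of basis is immaterial.\<close>

definition tr :: "('k::field \<Rightarrow> 'v::ab_group_add \<Rightarrow> 'v) \<Rightarrow> ('a \<Rightarrow> 'v \<Rightarrow> 'v) \<Rightarrow> 'a \<Rightarrow> 'k" where
  "tr sV act x =
     (let B = (SOME B. \<not> module.dependent sV B \<and> module.span sV B = UNIV)
      in \<Sum>b\<in>B. module.representation sV B (act x b) b)"


section \<open>Primitive idempotents\<close>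

definition eigvals :: "('k::field \<Rightarrow> 'v::ab_group_add \<Rightarrow> 'v) \<Rightarrow> ('a \<Rightarrow> 'v \<Rightarrow> 'v) \<Rightarrow> 'a \<Rightarrow> 'k set" where
  "eigvals sV act x = {t. \<exists>v. v \<noteq> 0 \<and> act x v = sV t v}"

definition multiplicity_free ::
  "nat \<Rightarrow> ('k::field \<Rightarrow> 'v::ab_group_add \<Rightarrow> 'v) \<Rightarrow> ('a \<Rightarrow> 'v \<Rightarrow> 'v) \<Rightarrow> 'a \<Rightarrow> bool" where
  "multiplicity_free d sV act x \<longleftrightarrow> card (eigvals sV act x) = d + 1"

text \<open>The product is taken over a list because the algebra is not commutative; the factors
  commute with each other, so their order does not matter.\<close>

definition primitive_idempotent ::
  "nat \<Rightarrow> ('k::field \<Rightarrow> 'a::ring_1 \<Rightarrow> 'a) \<Rightarrow> 'a \<Rightarrow> (nat \<Rightarrow> 'k) \<Rightarrow> nat \<Rightarrow> 'a" where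
  "primitive_idempotent d sA x \<theta> i =
     prod_list (map (\<lambda>j. sA (1 / (\<theta> i - \<theta> j)) (x - sA (\<theta> j) 1)) (filter (\<lambda>j. j \<noteq> i) [0..<d+1]))"

text \<open>\<open>E 0, \<dots>, E d\<close> is the ordering of the primitive idempotents of \<open>x\<close> that corresponds to
  the ordering \<open>\<theta> 0, \<dots>, \<theta> d\<close> of its eigenvalues.\<close>

definition idempotent_ordering ::
  "nat \<Rightarrow> ('k::field \<Rightarrow> 'a::ring_1 \<Rightarrow> 'a) \<Rightarrow> ('k \<Rightarrow> 'v::ab_group_add \<Rightarrow> 'v) \<Rightarrow> ('a \<Rightarrow> 'v \<Rightarrow> 'v)
    \<Rightarrow> 'a \<Rightarrow> (nat \<Rightarrow> 'a) \<Rightarrow> (nat \<Rightarrow> 'k) \<Rightarrow> bool" where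
  "idempotent_ordering d sA sV act x E \<theta> \<longleftrightarrow>
     bij_betw \<theta> {0..d} (eigvals sV act x) \<and>
     (\<forall>i\<in>{0..d}. E i = primitive_idempotent d sA x \<theta> i)"

definition assoc_eigval ::
  "nat \<Rightarrow> ('k::field \<Rightarrow> 'a::ring_1 \<Rightarrow> 'a) \<Rightarrow> ('k \<Rightarrow> 'v::ab_group_add \<Rightarrow> 'v) \<Rightarrow> ('a \<Rightarrow> 'v \<Rightarrow> 'v)
    \<Rightarrow> 'a \<Rightarrow> (nat \<Rightarrow> 'a) \<Rightarrow> nat \<Rightarrow> 'k" where
  "assoc_eigval d sA sV act x E i =
     (THE t. \<exists>\<theta>. idempotent_ordering d sA sV act x E \<theta> \<and> t = \<theta> i)"


section \<open>Leonard systems\<close>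

text \<open>\<open>(A, E, As, Es)\<close> stands for $(A; \{E_i\}_{i=0}^d; A^*; \{E^*_i\}_{i=0}^d)$;
  only the values of \<open>E\<close> and \<open>Es\<close> on \<open>{0..d}\<close> are meaningful.\<close>

type_synonym 'a system = "'a \<times> (nat \<Rightarrow> 'a) \<times> 'a \<times> (nat \<Rightarrow> 'a)"

definition Leonard_system ::
  "nat \<Rightarrow> ('k::field \<Rightarrow> 'a::ring_1 \<Rightarrow> 'a) \<Rightarrow> ('k \<Rightarrow> 'v::ab_group_add \<Rightarrow> 'v) \<Rightarrow> ('a \<Rightarrow> 'v \<Rightarrow> 'v)
    \<Rightarrow> 'a system \<Rightarrow> bool" where
  "Leonard_system d sA sV act = (\<lambda>(A, E, As, Es).
     multiplicity_free d sV act A \<and> multiplicity_free d sV act As \<and>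
     (\<exists>\<theta>. idempotent_ordering d sA sV act A E \<theta>) \<and>
     (\<exists>\<theta>s. idempotent_ordering d sA sV act As Es \<theta>s) \<and>
     (\<forall>i\<in>{0..d}. \<forall>j\<in>{0..d}.
        (\<bar>int i - int j\<bar> > 1 \<longrightarrow> E i * As * E j = 0) \<and>
        (\<bar>int i - int j\<bar> = 1 \<longrightarrow> E i * As * E j \<noteq> 0)) \<and>
     (\<forall>i\<in>{0..d}. \<forall>j\<in>{0..d}.
        (\<bar>int i - int j\<bar> > 1 \<longrightarrow> Es i * A * Es j = 0) \<and>
        (\<bar>int i - int j\<bar> = 1 \<longrightarrow> Es i * A * Es j \<noteq> 0)))"

definition dual :: "'a system \<Rightarrow> 'a system" where
  "dual = (\<lambda>(A, E, As, Es). (As, Es, A, E))"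

text \<open>$\Phi^{\downarrow}$ reverses the $E^*_i$, and $\Phi^{\Downarrow}$ reverses the $E_i$.\<close>

definition down :: "nat \<Rightarrow> 'a system \<Rightarrow> 'a system" where
  "down d = (\<lambda>(A, E, As, Es). (A, E, As, \<lambda>i. Es (d - i)))"

definition Down :: "nat \<Rightarrow> 'a system \<Rightarrow> 'a system" where
  "Down d = (\<lambda>(A, E, As, Es). (A, \<lambda>i. E (d - i), As, Es))"


section \<open>Split decomposition, split sequences, split idempotents\<close>

text \<open>The sums below are sums of subsets of \<open>V\<close> as in \<^theory>\<open>HOL-Library.Set_Algebras\<close>.\<close>

definition split_component ::
  "nat \<Rightarrow> ('a \<Rightarrow> 'v::ab_group_add \<Rightarrow> 'v) \<Rightarrow> 'a system \<Rightarrow> nat \<Rightarrow> 'v set" where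
  "split_component d act = (\<lambda>(A, E, As, Es) i.
     (\<Sum>j\<in>{0..i}. range (act (Es j))) \<inter> (\<Sum>j\<in>{i..d}. range (act (E j))))"

definition first_split ::
  "nat \<Rightarrow> ('k::field \<Rightarrow> 'a::ring_1 \<Rightarrow> 'a) \<Rightarrow> ('k \<Rightarrow> 'v::ab_group_add \<Rightarrow> 'v) \<Rightarrow> ('a \<Rightarrow> 'v \<Rightarrow> 'v)
    \<Rightarrow> 'a system \<Rightarrow> nat \<Rightarrow> 'k" where
  "first_split d sA sV act = (\<lambda>(A, E, As, Es) i.
     let \<theta> = assoc_eigval d sA sV act A E;
         \<theta>s = assoc_eigval d sA sV act As Es
     in (THE c. \<exists>u \<in> split_component d act (A, E, As, Es) i.
           u \<noteq> 0 \<and> act ((A - sA (\<theta> (i - 1)) 1) * (As - sA (\<theta>s i) 1)) u = sV c u))"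

definition second_split ::
  "nat \<Rightarrow> ('k::field \<Rightarrow> 'a::ring_1 \<Rightarrow> 'a) \<Rightarrow> ('k \<Rightarrow> 'v::ab_group_add \<Rightarrow> 'v) \<Rightarrow> ('a \<Rightarrow> 'v \<Rightarrow> 'v)
    \<Rightarrow> 'a system \<Rightarrow> nat \<Rightarrow> 'k" where
  "second_split d sA sV act \<Phi> = first_split d sA sV act (Down d \<Phi>)"

definition split_basis ::
  "nat \<Rightarrow> ('k::field \<Rightarrow> 'a::ring_1 \<Rightarrow> 'a) \<Rightarrow> ('k \<Rightarrow> 'v::ab_group_add \<Rightarrow> 'v) \<Rightarrow> ('a \<Rightarrow> 'v \<Rightarrow> 'v)
    \<Rightarrow> 'a system \<Rightarrow> (nat \<Rightarrow> 'v) \<Rightarrow> bool" where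
  "split_basis d sA sV act = (\<lambda>(A, E, As, Es) u.
     inj_on u {0..d} \<and> \<not> module.dependent sV (u ` {0..d}) \<and> module.span sV (u ` {0..d}) = UNIV \<and>
     (\<forall>i\<in>{0..d}. u i \<noteq> 0 \<and> u i \<in> split_component d act (A, E, As, Es) i) \<and>
     (\<forall>i<d. act (A - sA (assoc_eigval d sA sV act A E i) 1) (u i) = u (i + 1)))"

text \<open>The condition on \<open>x\<close> says that the matrix \<open>X\<close> of \<open>x\<close> with respect to the basis \<open>u\<close>, i.e.\
  \<open>x u\<^sub>j = (\<Sum>i. X\<^sub>i\<^sub>j u\<^sub>i)\<close>, has entry 1 at \<open>(k, k)\<close> and 0 elsewhere.\<close>

definition split_idempotent ::
  "nat \<Rightarrow> ('k::field \<Rightarrow> 'a::ring_1 \<Rightarrow> 'a) \<Rightarrow> ('k \<Rightarrow> 'v::ab_group_add \<Rightarrow> 'v) \<Rightarrow> ('a \<Rightarrow> 'v \<Rightarrow> 'v)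
    \<Rightarrow> 'a system \<Rightarrow> nat \<Rightarrow> 'a" where
  "split_idempotent d sA sV act \<Phi> k =
     (THE x. \<exists>u. split_basis d sA sV act \<Phi> u \<and>
        (\<forall>j\<in>{0..d}. act x (u j) = (if j = k then u k else 0)))"

end

theory Submission
  imports Defs
begin

text \<open>
  Let $u_0, \dots, u_d$ be a split basis. Then $A u_i = \theta_i u_i + u_{i+1}$ and
  $A^* u_i = \theta^*_i u_i + \varphi_i u_{i-1}$, so the $(k,k)$-entry of $AA^* - A^*A$ in this basis
  is $\varphi_k - \varphi_{k+1}$ with $\varphi_0 = \varphi_{d+1} = 0$ (\<open>commutator_diagonal\<close>). As
  $F_k$ is the projection onto the line of $u_k$, the trace of $(AA^* - A^*A)F_k$ is that entry
  (\<open>tr_rank_one\<close>), and the sums in the theorem telescope to $\varphi_i$ from either end.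

  The formulas with $F^*_k$ follow from the same computation for $\Phi^*$ once it is known that
  $\Phi$ and $\Phi^*$ have the same first split sequence (\<open>dual_\<phi>\<close>). For this, and also to obtain
  the split basis itself, $V$ is given a symmetric bilinear form for which $A$ and $A^*$ are
  self-adjoint; it exists because an irreducible tridiagonal matrix can be symmetrized by a
  diagonal one. Put $u_0 \in E^*_0V$, $u_{i+1} = (A - \theta_i) u_i$ and, dually,
  $u^*_0 \in E_0V$, $u^*_{i+1} = (A^* - \theta^*_i) u^*_i$. Comparing supports in the two orthogonal
  eigenbases shows that $\langle u_i, u^*_k\rangle$ vanishes exactly for $i \neq k$. Hence both
  families are bases, the coordinates with respect to one are, up to scaling, pairings with the
  other, and both split sequences equal
  $\langle u_i, u^*_i\rangle / \langle u_{i-1}, u^*_{i-1}\rangle$ by self-adjointness.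

  The second block of formulas is the first one for $\Phi^{\Downarrow}$: the split decomposition
  of $\Phi^{\downarrow}$ is that of $(\Phi^{\Downarrow})^*$ in the reverse order, so that
  $F^{\downarrow}_k$ is the $(d-k)$-th idempotent of $(\Phi^{\Downarrow})^*$
  (\<open>split_idempotent_down\<close>).
\<close>

section \<open>Bases with coordinate functionals\<close>

lemma sum_eq_single_term:
  fixes f :: "nat \<Rightarrow> 'b::comm_monoid_add"
  assumes "i \<le> d" "\<And>j. \<lbrakk>j \<le> d; j \<noteq> i\<rbrakk> \<Longrightarrow> f j = 0"
  shows "(\<Sum>j\<le>d. f j) = f i"
  using assms by (subst sum.remove[of _ i]) (auto intro: sum.neutral)

text \<open>The coordinate functionals are a parameter rather than derived from the vectors, because the
  split bases below come with functionals given by a formula, and because it makes being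
  tridiagonal with respect to a basis an explicit condition on numbers.
  Only the indices \<open>0, \<dots>, d\<close> carry meaning.\<close>

locale indexed_basis = vector_space scale
  for scale :: "'k::field \<Rightarrow> 'v::ab_group_add \<Rightarrow> 'v" (infixr \<open>*s\<close> 75) +
  fixes d :: nat and x :: "nat \<Rightarrow> 'v" and \<xi> :: "nat \<Rightarrow> 'v \<Rightarrow> 'k"
  assumes coord_add: "i \<le> d \<Longrightarrow> \<xi> i (v + w) = \<xi> i v + \<xi> i w"
    and coord_scale: "i \<le> d \<Longrightarrow> \<xi> i (c *s v) = c * \<xi> i v"
    and coord_basis: "\<lbrakk>i \<le> d; j \<le> d\<rbrakk> \<Longrightarrow> \<xi> i (x j) = (if i = j then 1 else 0)"
    and expand: "v = (\<Sum>i\<le>d. \<xi> i v *s x i)"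
begin

lemma coord_zero: "i \<le> d \<Longrightarrow> \<xi> i 0 = 0"
  using coord_scale[of i 0 0] by simp

lemma coord_diff: "i \<le> d \<Longrightarrow> \<xi> i (v - w) = \<xi> i v - \<xi> i w"
  using coord_add[of i "v - w" w] by simp

lemma coord_sum: "i \<le> d \<Longrightarrow> \<xi> i (\<Sum>j\<in>J. f j) = (\<Sum>j\<in>J. \<xi> i (f j))"
  by (induction J rule: infinite_finite_induct) (simp_all add: coord_zero coord_add)

lemma basis_nonzero: "i \<le> d \<Longrightarrow> x i \<noteq> 0"
  using coord_basis[of i i] coord_zero[of i] by auto

lemma eq_if_coords_eq: "(\<And>i. i \<le> d \<Longrightarrow> \<xi> i v = \<xi> i w) \<Longrightarrow> v = w"
  by (subst expand[of v], subst expand[of w]) simp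

lemma eq_zero_if_coords_zero: "(\<And>i. i \<le> d \<Longrightarrow> \<xi> i v = 0) \<Longrightarrow> v = 0"
  by (rule eq_if_coords_eq) (simp add: coord_zero)

lemma eq_if_single_coord:
  assumes "i \<le> d" "\<And>j. j \<le> d \<Longrightarrow> j \<noteq> i \<Longrightarrow> \<xi> j v = 0"
  shows "v = \<xi> i v *s x i"
  by (rule eq_if_coords_eq) (use assms in \<open>auto simp: coord_scale coord_basis\<close>)

lemma inj_on_basis: "inj_on x {..d}"
proof (rule inj_onI)
  fix i j assume "i \<in> {..d}" "j \<in> {..d}" "x i = x j"
  then show "i = j" using coord_basis[of i i] coord_basis[of i j] by (auto split: if_splits)
qed

lemma linear_eq_on_basis:
  assumes "Vector_Spaces.linear scale scale S" "Vector_Spaces.linear scale scale T"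
    and "\<And>i. i \<le> d \<Longrightarrow> S (x i) = T (x i)"
  shows "S v = T v"
proof -
  interpret S: Vector_Spaces.linear scale scale S by fact
  interpret T: Vector_Spaces.linear scale scale T by fact
  show ?thesis
    by (subst (1 2) expand[of v]) (simp add: S.sum T.sum S.scale T.scale assms(3))
qed

lemma span_basis: "span (x ` {..d}) = UNIV"
proof -
  have "v \<in> span (x ` {..d})" for v
    by (subst expand[of v]) (intro span_sum span_scale span_base imageI)
  then show ?thesis by auto
qed

lemma independent_basis: "independent (x ` {..d})"
proof
  assume "dependent (x ` {..d})"
  then obtain f where f: "(\<Sum>w\<in>x ` {..d}. f w *s w) = 0" and "\<exists>w\<in>x ` {..d}. f w \<noteq> 0"
    using dependent_finite[of "x ` {..d}"] by auto
  then obtain k where k: "k \<le> d" "f (x k) \<noteq> 0" by auto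
  have "0 = \<xi> k (\<Sum>i\<le>d. f (x i) *s x i)"
    using f by (simp add: sum.reindex[OF inj_on_basis] coord_zero[OF k(1)])
  also have "\<dots> = f (x k)"
    using k(1) by (simp add: coord_sum coord_scale coord_basis if_distrib[of "(*) _"] cong: if_cong)
  finally show False using k(2) by simp
qed

end

text \<open>A counting argument: \<open>d + 1\<close> independent vectors in a space that is spanned by at most
  \<open>d + 1\<close> vectors must themselves span it.\<close>

lemma (in vector_space) indexed_basis_if_spanning_bound:
  assumes S: "finite S" "card S \<le> d + 1" "span S = UNIV"
    and indep: "\<And>c i. \<lbrakk>(\<Sum>i\<le>d. scale (c i) (x i)) = 0; i \<le> d\<rbrakk> \<Longrightarrow> c i = 0"
  shows "\<exists>\<xi>. indexed_basis scale d x \<xi>"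
proof -
  let ?X = "x ` {..d}"
  have delta: "(\<Sum>l\<le>d. scale (if l = i then a else 0) (x l)) = scale a (x i)" if "i \<le> d" for i a
  proof -
    have "(\<Sum>l\<le>d. scale (if l = i then a else 0) (x l)) = (\<Sum>l\<le>d. if l = i then scale a (x i) else 0)"
      by (rule sum.cong) auto
    also have "\<dots> = scale a (x i)" using that by simp
    finally show ?thesis .
  qed
  have inj: "inj_on x {..d}"
  proof (rule inj_onI)
    fix i j assume ij: "i \<in> {..d}" "j \<in> {..d}" "x i = x j"
    have "(\<Sum>l\<le>d. scale ((if l = i then 1 else 0) - (if l = j then 1 else 0)) (x l)) = 0"
      using ij by (simp add: scale_left_diff_distrib sum_subtractf delta del: if_distrib)
    from indep[OF this, of i] ij show "i = j" by (auto split: if_splits)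
  qed
  have ind: "independent ?X"
  proof
    assume "dependent ?X"
    then obtain f where f: "(\<Sum>w\<in>?X. scale (f w) w) = 0" and "\<exists>w\<in>?X. f w \<noteq> 0"
      using dependent_finite[of ?X] by auto
    then obtain k where k: "k \<le> d" "f (x k) \<noteq> 0" by auto
    have "(\<Sum>i\<le>d. scale (f (x i)) (x i)) = 0" using f by (simp add: sum.reindex[OF inj])
    from indep[OF this k(1)] k(2) show False by simp
  qed
  have sp: "span ?X = UNIV"
  proof -
    obtain B where B: "B \<subseteq> S" "independent B" "S \<subseteq> span B"
      using maximal_independent_subset[of S] by blast
    have "span B = UNIV" using span_mono[OF B(3)] S(3) by (auto simp: span_span)
    then interpret finite_dimensional_vector_space scale B
      by unfold_locales (use B S finite_subset in auto)
    have "card B \<le> d + 1" using card_mono[OF S(1) B(1)] S(2) by simp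
    then have "dim UNIV \<le> card ?X"
      by (simp add: dim_UNIV card_image[OF inj])
    from card_ge_dim_independent[OF _ ind this] show ?thesis by auto
  qed
  have rep: "v = (\<Sum>i\<le>d. scale (representation ?X v (x i)) (x i))" for v
    using sum_representation_eq[OF ind, of v ?X] sp by (simp add: sum.reindex[OF inj])
  have "indexed_basis scale d x (\<lambda>i v. representation ?X v (x i))"
  proof (unfold_locales, goal_cases)
    case (1 i v w) show ?case using sp by (simp add: representation_add[OF ind])
  next
    case (2 i c v) show ?case using sp by (simp add: representation_scale[OF ind])
  next
    case (3 i j) then show ?case
      using inj_onD[OF inj] by (auto simp: representation_basis[OF ind])
  next
    case (4 v) show ?case by (rule rep)
  qed
  then show ?thesis by blast
qed

text \<open>Applying \<open>\<mu> k\<close> to a linear combination of the \<open>u i\<close> picks out its \<open>k\<close>-th coefficient. So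
  the \<open>u i\<close> are independent, by their number they form a basis, and the \<open>\<mu> k\<close> are its
  coordinate functionals.\<close>

lemma (in indexed_basis) indexed_basis_if_biorthogonal:
  assumes add: "\<And>k v w. k \<le> d \<Longrightarrow> \<mu> k (v + w) = \<mu> k v + \<mu> k w"
    and scale: "\<And>k c v. k \<le> d \<Longrightarrow> \<mu> k (c *s v) = c * \<mu> k v"
    and biorth: "\<And>k j. \<lbrakk>k \<le> d; j \<le> d\<rbrakk> \<Longrightarrow> \<mu> k (u j) = (if k = j then 1 else 0)"
  shows "indexed_basis scale d u \<mu>"
proof -
  have zero: "\<mu> k 0 = 0" if "k \<le> d" for k using scale[OF that, of 0 0] by simp
  have sum: "\<mu> k (\<Sum>i\<le>d. c i *s u i) = c k" if "k \<le> d" for k c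
  proof -
    have "\<mu> k (\<Sum>i\<in>J. f i) = (\<Sum>i\<in>J. \<mu> k (f i))" for J :: "nat set" and f
      by (induction J rule: infinite_finite_induct) (use that in \<open>simp_all add: zero add\<close>)
    then show ?thesis using that by (simp add: scale biorth if_distrib[of "(*) _"] cong: if_cong)
  qed
  have card: "card (x ` {..d}) \<le> d + 1"
    using card_image_le[of "{..d}" x] by simp
  have indep: "c i = 0" if "(\<Sum>i\<le>d. c i *s u i) = 0" "i \<le> d" for c i
    using sum[OF that(2), of c] that zero by simp
  obtain \<nu> where "indexed_basis scale d u \<nu>"
    using indexed_basis_if_spanning_bound[of "x ` {..d}" d u] card span_basis indep by blast
  then interpret U: indexed_basis scale d u \<nu> .
  have "\<nu> k v = \<mu> k v" if "k \<le> d" for k v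
    by (subst (2) U.expand[of v]) (simp add: sum[OF that])
  then have "v = (\<Sum>i\<le>d. \<mu> i v *s u i)" for v
    using U.expand[of v] by simp
  then show ?thesis
    by unfold_locales (simp_all add: add scale biorth)
qed


section \<open>Tridiagonal pairs of eigenbases\<close>

text \<open>These are the vectors \<open>(T - \<theta> (i-1)) \<dots> (T - \<theta> 0) w\<close>. For \<open>T = A\<close> and \<open>w\<close> spanning
  $E^*_0V$ they form a split basis.\<close>

primrec split_vector :: "('k \<Rightarrow> 'v \<Rightarrow> 'v::ab_group_add) \<Rightarrow> ('v \<Rightarrow> 'v) \<Rightarrow> (nat \<Rightarrow> 'k) \<Rightarrow> 'v \<Rightarrow> nat \<Rightarrow> 'v" where
  "split_vector scale T \<theta> w 0 = w"
| "split_vector scale T \<theta> w (Suc i) =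
     T (split_vector scale T \<theta> w i) - scale (\<theta> i) (split_vector scale T \<theta> w i)"

text \<open>The content of a Leonard system in terms of vectors: \<open>x i\<close> spans $E_iV$, \<open>y i\<close> spans
  $E^*_iV$, the operator \<open>B\<close> is $A^*$, and the conditions on $E_iA^*E_j$ and $E^*_iAE^*_j$ say that
  $A^*$ is irreducible tridiagonal in the basis \<open>x\<close> and $A$ in the basis \<open>y\<close>. The assumptions
  are symmetric under exchanging the two bases and under reversing the order of either basis,
  which gives $\Phi^*$, $\Phi^{\downarrow}$ and $\Phi^{\Downarrow}$ at no cost.\<close>

locale Leonard_pair_bases =
  X: indexed_basis scale d x \<xi> + Y: indexed_basis scale d y \<eta> +
  A: Vector_Spaces.linear scale scale A + B: Vector_Spaces.linear scale scale B
  for scale :: "'k::field \<Rightarrow> 'v::ab_group_add \<Rightarrow> 'v" (infixr \<open>*s\<close> 75)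
    and d x \<xi> y \<eta> A B +
  fixes \<theta> \<theta>s :: "nat \<Rightarrow> 'k"
  assumes inj_\<theta>: "inj_on \<theta> {..d}" and inj_\<theta>s: "inj_on \<theta>s {..d}"
    and A_x: "i \<le> d \<Longrightarrow> A (x i) = \<theta> i *s x i"
    and B_y: "i \<le> d \<Longrightarrow> B (y i) = \<theta>s i *s y i"
    and B_tridiagonal: "\<lbrakk>i \<le> d; j \<le> d; Suc i < j \<or> Suc j < i\<rbrakk> \<Longrightarrow> \<xi> i (B (x j)) = 0"
    and B_irreducible: "\<lbrakk>i \<le> d; j \<le> d; i = Suc j \<or> j = Suc i\<rbrakk> \<Longrightarrow> \<xi> i (B (x j)) \<noteq> 0"
    and A_tridiagonal: "\<lbrakk>i \<le> d; j \<le> d; Suc i < j \<or> Suc j < i\<rbrakk> \<Longrightarrow> \<eta> i (A (y j)) = 0"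
    and A_irreducible: "\<lbrakk>i \<le> d; j \<le> d; i = Suc j \<or> j = Suc i\<rbrakk> \<Longrightarrow> \<eta> i (A (y j)) \<noteq> 0"
begin

lemma dual: "Leonard_pair_bases (*s) d y \<eta> x \<xi> B A \<theta>s \<theta>"
  by unfold_locales
    (simp_all add: inj_\<theta> inj_\<theta>s A_x B_y B_tridiagonal B_irreducible A_tridiagonal A_irreducible)

lemma reverse: "Leonard_pair_bases (*s) d (\<lambda>i. x (d - i)) (\<lambda>i. \<xi> (d - i)) y \<eta> A B (\<lambda>i. \<theta> (d - i)) \<theta>s"
proof -
  have reindex: "(\<Sum>i\<le>d. f (d - i)) = (\<Sum>i\<le>d. f i)" for f :: "nat \<Rightarrow> 'v"
    by (rule sum.reindex_bij_witness[where i = "\<lambda>i. d - i" and j = "\<lambda>i. d - i"]) auto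
  have expand: "v = (\<Sum>i\<le>d. \<xi> (d - i) v *s x (d - i))" for v
    using X.expand[of v] reindex[of "\<lambda>i. \<xi> i v *s x i"] by simp
  interpret X': indexed_basis "(*s)" d "\<lambda>i. x (d - i)" "\<lambda>i. \<xi> (d - i)"
    by unfold_locales
      (auto simp: X.coord_add X.coord_scale X.coord_basis intro: expand)
  show ?thesis
  proof (unfold_locales, goal_cases)
    case 1 show ?case
      by (rule inj_onI) (use inj_onD[OF inj_\<theta>] in \<open>metis atMost_iff diff_diff_cancel diff_le_self\<close>)
  next
    case (5 i j) then show ?case by (intro B_tridiagonal) auto
  next
    case (6 i j) then show ?case by (intro B_irreducible) auto
  qed (auto simp: inj_\<theta>s A_x B_y A_tridiagonal A_irreducible)
qed

lemma coord_A: "j \<le> d \<Longrightarrow> \<xi> j (A v) = \<theta> j * \<xi> j v"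
  by (subst X.expand[of v])
    (simp add: A.sum A.scale A_x X.coord_sum X.coord_scale X.coord_basis if_distrib[of "(*) _"] cong: if_cong)

lemma coord_B: "j \<le> d \<Longrightarrow> \<eta> j (B v) = \<theta>s j * \<eta> j v"
  by (subst Y.expand[of v])
    (simp add: B.sum B.scale B_y Y.coord_sum Y.coord_scale Y.coord_basis if_distrib[of "(*) _"] cong: if_cong)

lemma coord_A_expand: "j \<le> d \<Longrightarrow> \<eta> j (A v) = (\<Sum>l\<le>d. \<eta> l v * \<eta> j (A (y l)))"
  by (subst Y.expand[of v]) (simp add: A.sum A.scale Y.coord_sum Y.coord_scale)

definition u :: "nat \<Rightarrow> 'v" where "u = split_vector (*s) A \<theta> (y 0)"
definition us :: "nat \<Rightarrow> 'v" where "us = split_vector (*s) B \<theta>s (x 0)"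

lemma u_0: "u 0 = y 0" and u_Suc: "u (Suc i) = A (u i) - \<theta> i *s u i"
  by (simp_all add: u_def)

lemma coord_x_u_Suc: "j \<le> d \<Longrightarrow> \<xi> j (u (Suc i)) = (\<theta> j - \<theta> i) * \<xi> j (u i)"
  by (simp add: u_Suc X.coord_diff X.coord_scale coord_A algebra_simps)

text \<open>As \<open>A\<close> is tridiagonal in \<open>y\<close>, each application of \<open>A\<close> reaches at most one index further.
  As its subdiagonal has no zeros, it does reach that index, with a nonzero coefficient.
  Hence the \<open>u i\<close> are triangular with respect to the \<open>y i\<close>.\<close>

lemma coord_y_u_above: "\<lbrakk>j \<le> d; i < j\<rbrakk> \<Longrightarrow> \<eta> j (u i) = 0"
proof (induction i arbitrary: j)
  case 0 then show ?case by (simp add: u_0 Y.coord_basis)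
next
  case (Suc i)
  have "\<eta> l (u i) * \<eta> j (A (y l)) = 0" if "l \<le> d" for l
    using Suc that A_tridiagonal[of j l] by (cases "l \<le> i") auto
  then have "\<eta> j (A (u i)) = 0"
    using Suc.prems by (subst coord_A_expand) (auto intro!: sum.neutral)
  then show ?case
    using Suc by (simp add: u_Suc Y.coord_diff Y.coord_scale)
qed

lemma coord_y_u_diag: "i \<le> d \<Longrightarrow> \<eta> i (u i) \<noteq> 0"
proof (induction i)
  case 0 then show ?case by (simp add: u_0 Y.coord_basis)
next
  case (Suc i)
  have "\<eta> l (u i) * \<eta> (Suc i) (A (y l)) = 0" if "l \<le> d" "l \<noteq> i" for l
    using Suc.prems that A_tridiagonal[of "Suc i" l] coord_y_u_above[of l i]
    by (cases "l < i") auto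
  then have "\<eta> (Suc i) (A (u i)) = \<eta> i (u i) * \<eta> (Suc i) (A (y i))"
    using Suc.prems by (subst coord_A_expand, simp, intro sum_eq_single_term) auto
  then show ?case
    using Suc A_irreducible[of "Suc i" i] coord_y_u_above[of "Suc i" i]
    by (simp add: u_Suc Y.coord_diff Y.coord_scale)
qed

text \<open>The factor \<open>A - \<theta> j\<close> of \<open>u i\<close> annihilates the coordinate at \<open>x j\<close>. Together with
  the bound from the other side this puts \<open>u i\<close> into the \<open>i\<close>-th split component.\<close>

lemma coord_x_u_below: "\<lbrakk>j \<le> d; j < i\<rbrakk> \<Longrightarrow> \<xi> j (u i) = 0"
proof (induction i)
  case (Suc i) then show ?case by (cases "j = i") (simp_all add: coord_x_u_Suc)
qed simp

text \<open>The \<open>u i\<close> are polynomials in \<open>A\<close> applied to \<open>y 0\<close>, and \<open>\<xi> k\<close> is an eigenfunctional of \<open>A\<close>. If it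
  vanished on \<open>y 0\<close>, it would vanish on all \<open>u i\<close>, hence by triangularity on all \<open>y i\<close>, hence
  everywhere.\<close>

lemma coord_x_y0_nonzero:
  assumes k: "k \<le> d" shows "\<xi> k (y 0) \<noteq> 0"
proof
  assume "\<xi> k (y 0) = 0"
  then have zero_u: "\<xi> k (u i) = 0" for i
    by (induction i) (use k in \<open>simp_all add: u_0 coord_x_u_Suc\<close>)
  have zero_y: "\<xi> k (y i) = 0" if "i \<le> d" for i
    using that
  proof (induction i rule: less_induct)
    case (less i)
    have "\<eta> l (u i) * \<xi> k (y l) = 0" if "l \<le> d" "l \<noteq> i" for l
      using less that coord_y_u_above[of l i] by (cases "l < i") auto
    then have "\<xi> k (u i) = \<eta> i (u i) * \<xi> k (y i)"
      using less.prems k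
      by (subst Y.expand[of "u i"], simp only: X.coord_sum X.coord_scale, intro sum_eq_single_term) auto
    then show ?case using zero_u coord_y_u_diag[OF less.prems] by simp
  qed
  have "\<xi> k (x k) = 0"
    by (subst Y.expand[of "x k"]) (use k zero_y in \<open>simp add: X.coord_sum X.coord_scale\<close>)
  then show False using k by (simp add: X.coord_basis)
qed

lemma coord_x_u_diag:
  assumes "i \<le> d" shows "\<xi> i (u i) \<noteq> 0"
proof -
  have "\<xi> i (u l) \<noteq> 0" if "l \<le> i" for l
    using that
  proof (induction l)
    case 0 then show ?case using assms by (simp add: u_0 coord_x_y0_nonzero)
  next
    case (Suc l)
    then show ?case using assms inj_onD[OF inj_\<theta>, of i l] by (auto simp: coord_x_u_Suc)
  qed
  then show ?thesis by simp
qed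

lemma u_end: "u (Suc d) = 0"
  by (rule X.eq_zero_if_coords_zero) (simp add: coord_x_u_below)

text \<open>The vectors \<open>us i\<close> are the \<open>u i\<close> of the dual system, so the facts about \<open>u\<close> transfer to them
  with the roles of \<open>x\<close> and \<open>y\<close> exchanged.\<close>

lemma dual_u: "Leonard_pair_bases.u (*s) x B \<theta>s = us"
proof -
  interpret D: Leonard_pair_bases "(*s)" d y \<eta> x \<xi> B A \<theta>s \<theta> by (rule dual)
  show ?thesis by (simp add: D.u_def us_def)
qed

lemma coord_x_us_above: "\<lbrakk>j \<le> d; i < j\<rbrakk> \<Longrightarrow> \<xi> j (us i) = 0"
  using Leonard_pair_bases.coord_y_u_above[OF dual] by (simp add: dual_u)

lemma coord_y_us_below: "\<lbrakk>j \<le> d; j < i\<rbrakk> \<Longrightarrow> \<eta> j (us i) = 0"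
  using Leonard_pair_bases.coord_x_u_below[OF dual] by (simp add: dual_u)

lemma coord_y_us_diag: "i \<le> d \<Longrightarrow> \<eta> i (us i) \<noteq> 0"
  using Leonard_pair_bases.coord_x_u_diag[OF dual] by (simp add: dual_u)

text \<open>An irreducible tridiagonal matrix becomes symmetric after rescaling its basis. The weights are
  the rescaling factors for the matrix of \<open>A\<close> in the basis \<open>y\<close>, determined up to a common
  factor by the requirement that opposite off-diagonal entries agree.\<close>

primrec weight :: "nat \<Rightarrow> 'k" where
  "weight 0 = 1"
| "weight (Suc j) = weight j * \<eta> j (A (y (Suc j))) / \<eta> (Suc j) (A (y j))"

text \<open>The symmetric bilinear form for which the \<open>y i\<close> are orthogonal and both \<open>A\<close> and \<open>B\<close> are
  self-adjoint. Taking adjoints for it is the antiautomorphism of the algebra that fixes $A$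
  and $A^*$.\<close>

definition form :: "'v \<Rightarrow> 'v \<Rightarrow> 'k" where
  "form a b = (\<Sum>j\<le>d. weight j * \<eta> j a * \<eta> j b)"

lemma weight_nonzero: "j \<le> d \<Longrightarrow> weight j \<noteq> 0"
  by (induction j) (auto simp: A_irreducible)

lemma weight_symmetric:
  assumes "i \<le> d" "j \<le> d"
  shows "weight j * \<eta> j (A (y i)) = weight i * \<eta> i (A (y j))"
proof -
  have step: "weight (Suc l) * \<eta> (Suc l) (A (y l)) = weight l * \<eta> l (A (y (Suc l)))" if "Suc l \<le> d" for l
    using that A_irreducible[of "Suc l" l] by simp
  consider "i = j" | "i = Suc j" | "j = Suc i" | "Suc i < j \<or> Suc j < i" by linarith
  then show ?thesis
    by cases (use assms step A_tridiagonal in \<open>auto simp del: weight.simps\<close>)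
qed

lemma form_add_left: "form (a + b) c = form a c + form b c"
  and form_scale_left: "form (t *s a) c = t * form a c"
  and form_commute: "form a c = form c a"
  by (simp_all add: form_def Y.coord_add Y.coord_scale sum_distrib_left sum.distrib algebra_simps)

lemma form_add_right: "form a (b + c) = form a b + form a c"
  and form_scale_right: "form a (t *s c) = t * form a c"
  by (simp_all add: form_commute[of a] form_add_left form_scale_left)

lemma form_zero: "form 0 c = 0" "form c 0 = 0"
  using form_scale_left[of 0 0] form_scale_right[of _ 0 0] by simp_all

lemma form_sum_left: "form (\<Sum>i\<in>I. f i) c = (\<Sum>i\<in>I. form (f i) c)"
  by (induction I rule: infinite_finite_induct) (simp_all add: form_zero form_add_left)

lemma form_sum_right: "form c (\<Sum>i\<in>I. f i) = (\<Sum>i\<in>I. form c (f i))"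
  by (simp add: form_commute[of c] form_sum_left)

lemma form_B: "form (B a) b = form a (B b)"
  by (simp add: form_def coord_B algebra_simps)

lemma form_A: "form (A a) b = form a (A b)"
proof -
  have "form (A a) b = (\<Sum>j\<le>d. \<Sum>i\<le>d. (weight j * \<eta> j (A (y i))) * \<eta> i a * \<eta> j b)"
    by (simp add: form_def coord_A_expand[of _ a] sum_distrib_left sum_distrib_right algebra_simps)
  also have "\<dots> = (\<Sum>j\<le>d. \<Sum>i\<le>d. (weight i * \<eta> i (A (y j))) * \<eta> i a * \<eta> j b)"
    by (intro sum.cong refl) (use weight_symmetric in auto)
  also have "\<dots> = (\<Sum>i\<le>d. \<Sum>j\<le>d. (weight i * \<eta> i (A (y j))) * \<eta> i a * \<eta> j b)"
    by (rule sum.swap)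
  also have "\<dots> = form a (A b)"
    by (simp add: form_def coord_A_expand[of _ b] sum_distrib_left sum_distrib_right algebra_simps)
  finally show ?thesis .
qed

text \<open>Eigenvectors of a self-adjoint operator for distinct eigenvalues are orthogonal.\<close>

lemma form_x_orthogonal:
  assumes "i \<le> d" "j \<le> d" "i \<noteq> j" shows "form (x i) (x j) = 0"
proof -
  have "\<theta> i * form (x i) (x j) = \<theta> j * form (x i) (x j)"
    using form_A[of "x i" "x j"] assms by (simp add: A_x form_scale_left form_scale_right)
  moreover have "\<theta> i \<noteq> \<theta> j" using inj_onD[OF inj_\<theta>, of i j] assms by auto
  ultimately show ?thesis by simp
qed

lemma form_x: "form a b = (\<Sum>i\<le>d. form (x i) (x i) * \<xi> i a * \<xi> i b)"
proof -
  have "form a b = (\<Sum>i\<le>d. \<Sum>j\<le>d. \<xi> i a * (\<xi> j b * form (x i) (x j)))"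
    by (subst X.expand[of a], subst X.expand[of b])
      (simp only: form_sum_left form_scale_left, simp only: form_sum_right form_scale_right sum_distrib_left)
  also have "\<dots> = (\<Sum>i\<le>d. \<Sum>j\<le>d. if j = i then form (x i) (x i) * \<xi> i a * \<xi> i b else 0)"
    by (intro sum.cong refl) (auto simp: form_x_orthogonal)
  finally show ?thesis by simp
qed

text \<open>A vector of the \<open>i\<close>-th split component is orthogonal to every \<open>us k\<close> with \<open>k \<noteq> i\<close>: for \<open>i < k\<close> the two
  have disjoint supports in the orthogonal basis \<open>y\<close>, for \<open>k < i\<close> they have disjoint supports
  in the orthogonal basis \<open>x\<close>.\<close>

lemma form_us_zero:
  assumes above: "\<And>j. \<lbrakk>j \<le> d; i < j\<rbrakk> \<Longrightarrow> \<eta> j w = 0"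
    and below: "\<And>j. \<lbrakk>j \<le> d; j < i\<rbrakk> \<Longrightarrow> \<xi> j w = 0"
    and "k \<noteq> i"
  shows "form w (us k) = 0"
proof (cases "i < k")
  case True
  have "\<eta> j w * \<eta> j (us k) = 0" if "j \<le> d" for j
    using that above coord_y_us_below[of j k] True by (cases "i < j") auto
  then show ?thesis unfolding form_def by (intro sum.neutral) (auto simp: mult.assoc)
next
  case False
  have "\<xi> j w * \<xi> j (us k) = 0" if "j \<le> d" for j
    using that below coord_x_us_above[of j k] False assms(3) by (cases "j < i") auto
  then show ?thesis by (subst form_x, intro sum.neutral) (auto simp: mult.assoc)
qed

lemma form_u_us: "k \<noteq> i \<Longrightarrow> form (u i) (us k) = 0"
  by (rule form_us_zero) (simp_all add: coord_y_u_above coord_x_u_below)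

text \<open>The supports of \<open>u i\<close> and \<open>us i\<close> in the orthogonal basis \<open>y\<close> meet in the single index \<open>i\<close>.\<close>

lemma form_u_us_nonzero:
  assumes "i \<le> d" shows "form (u i) (us i) \<noteq> 0"
proof -
  have "\<eta> j (u i) * \<eta> j (us i) = 0" if "j \<le> d" "j \<noteq> i" for j
    using that coord_y_u_above[of j i] coord_y_us_below[of j i] by (cases "i < j") auto
  then have "form (u i) (us i) = weight i * \<eta> i (u i) * \<eta> i (us i)"
    using assms unfolding form_def by (intro sum_eq_single_term) (auto simp: mult.assoc)
  then show ?thesis
    using assms by (simp add: weight_nonzero coord_y_u_diag coord_y_us_diag)
qed

text \<open>The coordinate functionals of the basis \<open>u\<close>, read off from the biorthogonality of \<open>u\<close>
  and \<open>us\<close>.\<close>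

definition \<mu> :: "nat \<Rightarrow> 'v \<Rightarrow> 'k" where
  "\<mu> k a = form a (us k) / form (u k) (us k)"

text \<open>The first split sequence. The value \<open>0\<close> at the index \<open>0\<close>, matched by \<open>\<phi> (Suc d) = 0\<close>, makes the
  formula for \<open>B (u i)\<close> and the telescoping sums uniform at both ends.\<close>

definition \<phi> :: "nat \<Rightarrow> 'k" where
  "\<phi> i = (if i = 0 then 0 else form (u i) (us i) / form (u (i - 1)) (us (i - 1)))"

lemma \<phi>_end: "\<phi> (Suc d) = 0"
  by (simp add: \<phi>_def u_end form_zero)

sublocale U: indexed_basis "(*s)" d u \<mu>
  by (rule X.indexed_basis_if_biorthogonal)
    (auto simp: \<mu>_def form_add_left form_scale_left add_divide_distrib form_u_us form_u_us_nonzero)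

lemma A_u: "A (u i) = \<theta> i *s u i + u (Suc i)"
  by (simp add: u_Suc)

lemma B_us: "B (us i) = \<theta>s i *s us i + us (Suc i)"
  by (simp add: us_def)

text \<open>The coordinate of \<open>B (u i)\<close> at \<open>u k\<close> is a quotient whose numerator is
  \<open>form (B (u i)) (us k) = form (u i) (B (us k))\<close>, and \<open>B (us k)\<close> involves only \<open>us k\<close> and
  \<open>us (k + 1)\<close>. So only \<open>k = i\<close> and \<open>k = i - 1\<close> contribute.\<close>

lemma B_u:
  assumes i: "i \<le> d" shows "B (u i) = \<theta>s i *s u i + \<phi> i *s u (i - 1)"
proof (cases i)
  case 0 then show ?thesis by (simp add: u_0 B_y \<phi>_def)
next
  case (Suc l)
  show ?thesis
  proof (rule U.eq_if_coords_eq)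
    fix k assume k: "k \<le> d"
    have "form (B (u i)) (us k) = \<theta>s k * form (u i) (us k) + form (u i) (us (Suc k))"
      by (simp add: form_B B_us form_add_right form_scale_right)
    then have "\<mu> k (B (u i)) = (if k = i then \<theta>s i else if k = l then \<phi> i else 0)"
      using i k form_u_us_nonzero[OF k] Suc by (auto simp: \<mu>_def \<phi>_def form_u_us)
    also have "\<dots> = \<mu> k (\<theta>s i *s u i + \<phi> i *s u (i - 1))"
      using i k Suc by (simp add: U.coord_add U.coord_scale U.coord_basis)
    finally show "\<mu> k (B (u i)) = \<mu> k (\<theta>s i *s u i + \<phi> i *s u (i - 1))" .
  qed
qed

text \<open>In the basis \<open>u\<close>, \<open>A\<close> is lower bidiagonal with diagonal \<open>\<theta>\<close> and subdiagonal \<open>1\<close>, and \<open>B\<close> is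
  upper bidiagonal with diagonal \<open>\<theta>s\<close> and superdiagonal \<open>\<phi>\<close>. The contributions of the two
  diagonals to the commutator cancel.\<close>

lemma commutator_diagonal:
  assumes k: "k \<le> d" shows "\<mu> k (A (B (u k)) - B (A (u k))) = \<phi> k - \<phi> (Suc k)"
proof -
  have \<mu>_Suc: "\<mu> k (u (Suc k)) = 0"
    using k by (simp add: \<mu>_def form_u_us)
  have "\<mu> k (A (B (u k))) = \<theta>s k * \<theta> k + \<phi> k"
    using k \<mu>_Suc by (cases k)
      (simp_all add: B_u A.add A.scale A_u U.coord_add U.coord_scale U.coord_basis \<phi>_def)
  moreover have "\<mu> k (B (u (Suc k))) = \<phi> (Suc k)"
  proof (cases "k = d")
    case True then show ?thesis by (simp add: u_end \<phi>_end B.zero U.coord_zero)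
  next
    case False then show ?thesis
      using k by (simp add: B_u U.coord_add U.coord_scale U.coord_basis)
  qed
  then have "\<mu> k (B (A (u k))) = \<theta> k * \<theta>s k + \<phi> (Suc k)"
    using k by (simp add: A_u B.add B.scale B_u[OF k] U.coord_add U.coord_scale U.coord_basis)
      (cases k; simp add: U.coord_basis \<phi>_def)
  ultimately show ?thesis using k by (simp add: U.coord_diff mult.commute)
qed

text \<open>Moving \<open>A\<close> from \<open>u (i - 1)\<close> over to \<open>us i\<close> in \<open>form (A (u (i - 1))) (us i)\<close> shows that the
  split sequence of the dual system is given by the same quotient of values
  \<open>form (u i) (us i)\<close>.\<close>

lemma dual_\<phi>:
  assumes "i \<le> d" shows "Leonard_pair_bases.\<phi> (*s) d y x \<xi> B A \<theta>s \<theta> i = \<phi> i"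
proof (cases i)
  interpret D: Leonard_pair_bases "(*s)" d y \<eta> x \<xi> B A \<theta>s \<theta> by (rule dual)
  case 0 then show ?thesis by (simp add: \<phi>_def D.\<phi>_def)
next
  interpret D: Leonard_pair_bases "(*s)" d y \<eta> x \<xi> B A \<theta>s \<theta> by (rule dual)
  case (Suc l)
  have "form (u i) (us i) = form (u l) (A (us i))"
    by (simp add: Suc form_A[symmetric] A_u form_add_left form_scale_left form_u_us)
  also have "\<dots> = D.\<phi> i * form (u l) (us l)"
    using D.B_u[OF assms] Suc by (simp add: dual_u form_add_right form_scale_right form_u_us)
  finally show ?thesis
    using assms Suc form_u_us_nonzero[of l] by (simp add: \<phi>_def)
qed

text \<open>The split components are lines: all coordinates other than the \<open>i\<close>-th with respect to \<open>u\<close> are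
  values of the form that vanish by \<open>form_us_zero\<close>.\<close>

lemma split_component_line:
  assumes "i \<le> d"
    and "\<And>j. \<lbrakk>j \<le> d; i < j\<rbrakk> \<Longrightarrow> \<eta> j w = 0" "\<And>j. \<lbrakk>j \<le> d; j < i\<rbrakk> \<Longrightarrow> \<xi> j w = 0"
  shows "w = \<mu> i w *s u i"
  by (rule U.eq_if_single_coord) (use assms form_us_zero[of i w] in \<open>auto simp: \<mu>_def\<close>)

end


section \<open>Simple modules of matrix algebras\<close>

lemma matrix_units:
  fixes sA :: "'k::field \<Rightarrow> 'a::ring_1 \<Rightarrow> 'a"
  assumes "isomorphic_to_Mat n sA"
  obtains e c where "\<And>i j k l. \<lbrakk>i < n; j < n; k < n; l < n\<rbrakk> \<Longrightarrow> e i j * e k l = (if j = k then e i l else 0)"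
    and "(\<Sum>i<n. e i i) = 1" and "\<And>a. a = (\<Sum>i<n. \<Sum>j<n. sA (c a i j) (e i j))"
proof -
  obtain f :: "'a \<Rightarrow> 'k mat" where bij: "bij_betw f UNIV (carrier_mat n n)"
    and one: "f 1 = 1\<^sub>m n" and add: "\<And>a b. f (a + b) = f a + f b"
    and mult: "\<And>a b. f (a * b) = f a * f b" and scale: "\<And>c a. f (sA c a) = c \<cdot>\<^sub>m f a"
    using assms unfolding isomorphic_to_Mat_def by auto
  have carrier: "f a \<in> carrier_mat n n" for a using bij by (auto simp: bij_betw_def)
  note dims = carrier_matD[OF carrier]
  have inj: "a = b" if "\<And>i j. \<lbrakk>i < n; j < n\<rbrakk> \<Longrightarrow> f a $$ (i, j) = f b $$ (i, j)" for a b
    by (rule inj_onD[OF bij_betw_imp_inj_on[OF bij]]) (auto simp: dims that intro!: eq_matI)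
  have zero: "f 0 $$ (i, j) = 0" if "i < n" "j < n" for i j
  proof -
    have "f (0 + 0) $$ (i, j) = f 0 $$ (i, j) + f 0 $$ (i, j)"
      unfolding add[of 0 0] using that by (simp add: dims)
    then show ?thesis by (simp only: add_0 add_cancel_right_right)
  qed
  have sum: "f (\<Sum>s\<in>S. g s) $$ (i, j) = (\<Sum>s\<in>S. f (g s) $$ (i, j))"
    if "i < n" "j < n" for i j and S :: "nat set" and g
    by (induction S rule: infinite_finite_induct) (use that in \<open>simp_all add: zero add dims\<close>)
  define m where "m i j = inv_into UNIV f (mat n n (\<lambda>p. if p = (i, j) then 1 else 0))" for i j
  have f_m: "f (m i j) = mat n n (\<lambda>p. if p = (i, j) then 1 else 0)" for i j
    unfolding m_def by (rule f_inv_into_f) (use bij in \<open>auto simp: bij_betw_def\<close>)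
  define c where "c a i j = f a $$ (i, j)" for a i j
  have "m i j * m k l = (if j = k then m i l else 0)" if "i < n" "j < n" "k < n" "l < n" for i j k l
  proof (rule inj)
    fix p q assume pq: "p < n" "q < n"
    have "f (m i j * m k l) $$ (p, q) =
      (\<Sum>r<n. (if (p, r) = (i, j) then 1 else 0) * (if (r, q) = (k, l) then 1 else 0))"
      using pq by (simp add: mult f_m scalar_prod_def atLeast0LessThan)
    also have "\<dots> = (\<Sum>r<n. if r = j then (if p = i \<and> j = k \<and> q = l then 1 else 0) else 0)"
      by (intro sum.cong) auto
    also have "\<dots> = f (if j = k then m i l else 0) $$ (p, q)"
      using pq that by (auto simp: f_m zero)
    finally show "f (m i j * m k l) $$ (p, q) = f (if j = k then m i l else 0) $$ (p, q)" .
  qed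
  moreover have "(\<Sum>i<n. m i i) = 1"
  proof (rule inj)
    fix p q assume pq: "p < n" "q < n"
    have "(\<Sum>i<n. if p = i \<and> q = i then 1 else 0) = (\<Sum>i<n. if i = p then (if p = q then 1 else 0) else 0::'k)"
      by (intro sum.cong) auto
    then show "f (\<Sum>i<n. m i i) $$ (p, q) = f 1 $$ (p, q)"
      using pq by (simp add: sum f_m one)
  qed
  moreover have "a = (\<Sum>i<n. \<Sum>j<n. sA (c a i j) (m i j))" for a
  proof (rule inj)
    fix p q assume pq: "p < n" "q < n"
    have "(\<Sum>j<n. c a i j * (if p = i \<and> q = j then 1 else 0)) = (if i = p then c a p q else 0)" for i
      using pq by (cases "i = p") (simp_all add: if_distrib[of "(*) _"] cong: if_cong)
    then show "f a $$ (p, q) = f (\<Sum>i<n. \<Sum>j<n. sA (c a i j) (m i j)) $$ (p, q)"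
      using pq by (simp add: sum f_m scale dims c_def)
  qed
  ultimately show thesis by (rule that)
qed

context K_algebra_module
begin

lemma act_linear: "Vector_Spaces.linear sV sV (act a)"
proof unfold_locales
  fix b v w
  show "act a (v + w) = act a v + act a w" by (rule act_add_right)
  have "a * sA b 1 = sA b 1 * a"
    by (simp add: scale_mult_left scale_mult_right)
  then show "act a (sV b v) = sV b (act a v)"
    using act_mult[of a "sA b 1" v] act_mult[of "sA b 1" a v] by (simp add: act_scale act_one)
qed

lemma act_zero_left: "act 0 v = 0"
  using act_add_left[of 0 0 v] by simp

lemma act_zero_right: "act a 0 = 0"
  using act_add_right[of a 0 0] by simp

lemma act_minus_left: "act (a - b) v = act a v - act b v"
  using act_add_left[of "a - b" b v] by simp

lemma act_sum_left: "act (\<Sum>i\<in>I. f i) v = (\<Sum>i\<in>I. act (f i) v)"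
  by (induction I rule: infinite_finite_induct) (simp_all add: act_zero_left act_add_left)

lemma act_sum_right: "act a (\<Sum>i\<in>I. f i) = (\<Sum>i\<in>I. act a (f i))"
  by (induction I rule: infinite_finite_induct) (simp_all add: act_zero_right act_add_right)

lemma act_scale_right: "act a (sV c v) = sV c (act a v)"
proof -
  interpret Vector_Spaces.linear sV sV "act a" by (rule act_linear)
  show ?thesis by (rule scale)
qed

end

text \<open>The consequences of the isomorphism with a matrix algebra that the rest depends on: the module
  identifies the algebra with all linear endomorphisms of a space of dimension \<open>d + 1\<close>.\<close>

locale matrix_module = K_algebra_module sA sV act
  for sA :: "'k::field \<Rightarrow> 'a::ring_1 \<Rightarrow> 'a"
    and sV :: "'k \<Rightarrow> 'v::ab_group_add \<Rightarrow> 'v"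
    and act :: "'a \<Rightarrow> 'v \<Rightarrow> 'v" +
  fixes d :: nat
  assumes has_basis: "\<exists>w \<omega>. indexed_basis sV d w \<omega>"
    and faithful: "(\<And>v. act a v = act b v) \<Longrightarrow> a = b"
    and full: "Vector_Spaces.linear sV sV T \<Longrightarrow> \<exists>a. \<forall>v. act a v = T v"

text \<open>Some diagonal matrix unit \<open>e i i\<close> does not annihilate \<open>V\<close>. The images of a vector \<open>v\<close> with
  \<open>e i i v \<noteq> 0\<close> under the \<open>i\<close>-th column of matrix units are moved by the matrix units in the
  same way as standard basis vectors. Their span is a submodule, hence all of \<open>V\<close>, and in this basis every
  element of the algebra acts by its own matrix.\<close>

lemma (in simple_K_algebra_module) matrix_module_if_isomorphic:
  assumes iso: "isomorphic_to_Mat (d + 1) sA"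
  shows "matrix_module sA sV act d"
proof (rule matrix_units[OF iso])
  fix e c
  assume mult: "\<And>i j k l. \<lbrakk>i < d + 1; j < d + 1; k < d + 1; l < d + 1\<rbrakk> \<Longrightarrow>
        e i j * e k l = (if j = k then e i l else 0)"
    and "(\<Sum>i<d+1. e i i) = 1" and "\<And>a. a = (\<Sum>i<d+1. \<Sum>j<d+1. sA (c a i j) (e i j))"
  moreover have "{..<d + 1} = {..d}" by auto
  ultimately have one: "(\<Sum>i\<le>d. e i i) = 1"
    and expand: "\<And>a. a = (\<Sum>i\<le>d. \<Sum>j\<le>d. sA (c a i j) (e i j))"
    by (simp_all only:)
  obtain v i where i: "i \<le> d" and nz: "act (e i i) v \<noteq> 0"
  proof -
    obtain v :: 'v where "v \<noteq> 0" using nonzero by blast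
    moreover have "(\<Sum>i\<le>d. act (e i i) v) = v"
      using act_sum_left[of "\<lambda>i. e i i" "{..d}" v] by (simp add: one act_one)
    ultimately obtain i where "i \<in> {..d}" "act (e i i) v \<noteq> 0"
      using sum.not_neutral_contains_not_neutral[of "\<lambda>i. act (e i i) v" "{..d}"] by auto
    then show thesis using that by auto
  qed
  define w where "w l = act (e l i) v" for l
  have e_w: "act (e j k) (w l) = (if k = l then w j else 0)" if "j \<le> d" "k \<le> d" "l \<le> d" for j k l
    using that i by (simp add: w_def act_mult[symmetric] mult act_zero_left)
  have w_nz: "w l \<noteq> 0" if "l \<le> d" for l
    using e_w[of i l l] i that nz by (auto simp: w_def act_zero_right)
  have act_w: "act a (w l) = (\<Sum>j\<le>d. sV (c a j l) (w j))" if "l \<le> d" for a l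
  proof -
    have "act a (w l) = (\<Sum>j\<le>d. \<Sum>k\<le>d. sV (c a j k) (act (e j k) (w l)))"
      by (subst expand[of a]) (simp add: act_sum_left act_scale)
    also have "\<dots> = (\<Sum>j\<le>d. sV (c a j l) (w j))"
      using that by (intro sum.cong refl, subst sum_eq_single_term[of l]) (auto simp: e_w)
    finally show ?thesis .
  qed
  have indep: "t k = 0" if "(\<Sum>l\<le>d. sV (t l) (w l)) = 0" "k \<le> d" for t k
  proof -
    have "0 = (\<Sum>l\<le>d. sV (t l) (act (e k k) (w l)))"
      using arg_cong[OF that(1), of "act (e k k)"]
      by (simp add: act_sum_right act_scale_right act_zero_right)
    also have "\<dots> = sV (t k) (w k)"
      using that(2) by (subst sum_eq_single_term[of k]) (auto simp: e_w)
    finally show ?thesis using w_nz[OF that(2)] by simp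
  qed
  have "V.span (w ` {..d}) = UNIV"
  proof -
    have "act a z \<in> V.span (w ` {..d})" if "z \<in> V.span (w ` {..d})" for a z
      using that
    proof (induction rule: V.span_induct_alt)
      case base then show ?case by (simp add: act_zero_right V.span_zero)
    next
      case (step t b z)
      then obtain l where l: "l \<le> d" "b = w l" by auto
      then have "act a b \<in> V.span (w ` {..d})"
        by (simp only: act_w) (intro V.span_sum V.span_scale V.span_base imageI)
      then show ?case
        using step by (simp add: act_add_right act_scale_right V.span_add V.span_scale)
    qed
    from simple[OF V.subspace_span this] show ?thesis
      using w_nz[OF i] V.span_base[of "w i" "w ` {..d}"] i by auto
  qed
  then obtain \<omega> where "indexed_basis sV d w \<omega>"
    using V.indexed_basis_if_spanning_bound[of "w ` {..d}" d w] indep card_image_le[of "{..d}" w]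
    by auto
  then interpret W: indexed_basis sV d w \<omega> .
  show ?thesis
  proof
    show "\<exists>w \<omega>. indexed_basis sV d w \<omega>" using W.indexed_basis_axioms by blast
  next
    fix a b assume eq: "\<And>v. act a v = act b v"
    have "c a j l = c b j l" if "j \<le> d" "l \<le> d" for j l
    proof -
      have "c t j l = \<omega> j (act t (w l))" for t
        using that by (simp add: act_w W.coord_sum W.coord_scale W.coord_basis if_distrib[of "(*) _"] cong: if_cong)
      then show ?thesis using eq by simp
    qed
    then show "a = b" by (subst expand[of a], subst expand[of b]) simp
  next
    fix T assume T: "Vector_Spaces.linear sV sV T"
    define a where "a = (\<Sum>j\<le>d. \<Sum>k\<le>d. sA (\<omega> j (T (w k))) (e j k))"
    have "act a (w l) = T (w l)" if "l \<le> d" for l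
    proof -
      have "act a (w l) = (\<Sum>j\<le>d. \<Sum>k\<le>d. sV (\<omega> j (T (w k))) (act (e j k) (w l)))"
        by (simp add: a_def act_sum_left act_scale)
      also have "\<dots> = (\<Sum>j\<le>d. sV (\<omega> j (T (w l))) (w j))"
        using that by (intro sum.cong refl, subst sum_eq_single_term[of l]) (auto simp: e_w)
      finally show ?thesis by (simp only: W.expand[symmetric])
    qed
    then show "\<exists>a. \<forall>v. act a v = T v"
      using W.linear_eq_on_basis[OF act_linear T, of a] by blast
  qed
qed

text \<open>Expanding \<open>z\<close> in an arbitrary basis \<open>b\<close>, the trace of \<open>v \<mapsto> f v z\<close> is
  $\sum_b f(b) z_b = f(\sum_b z_b b) = f(z)$. So the basis that
  the definition of the trace picks does not affect the value.\<close>

lemma (in matrix_module) tr_rank_one: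
  assumes f: "Vector_Spaces.linear sV (*) f" and a: "\<And>v. act a v = sV (f v) z"
  shows "tr sV act a = f z"
proof -
  obtain w \<omega> where "indexed_basis sV d w \<omega>" using has_basis by blast
  then interpret W: indexed_basis sV d w \<omega> .
  interpret finite_dimensional_vector_space sV "w ` {..d}"
    by unfold_locales (simp_all add: W.independent_basis W.span_basis)
  define B where "B = (SOME B. \<not> V.dependent B \<and> V.span B = UNIV)"
  have "\<not> V.dependent B \<and> V.span B = UNIV"
    unfolding B_def by (rule someI_ex) (use W.independent_basis W.span_basis in blast)
  then have B: "V.independent B" "V.span B = UNIV" by auto
  have fin: "finite B" using finiteI_independent[OF B(1)] .
  interpret f: Vector_Spaces.linear sV "(*)" f by fact
  have "tr sV act a = (\<Sum>b\<in>B. V.representation B (act a b) b)"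
    by (simp only: tr_def B_def Let_def)
  also have "\<dots> = (\<Sum>b\<in>B. f (sV (V.representation B z b) b))"
    using B by (simp add: a V.representation_scale f.scale mult.commute)
  also have "\<dots> = f (\<Sum>b\<in>B. sV (V.representation B z b) b)"
    by (simp add: f.sum)
  also have "\<dots> = f z"
    using V.sum_representation_eq[OF B(1), of z B] B(2) fin by simp
  finally show ?thesis .
qed


section \<open>Leonard systems in coordinates\<close>

text \<open>A choice of eigenvectors and orderings of eigenvalues for a given Leonard system, with the
  idempotents acting as the coordinate projections. It passes to the relatives of the system
  by merely rearranging the parameters.\<close>

locale Leonard_realization =
  matrix_module sA sV act d +
  Leonard_pair_bases sV d x \<xi> y \<eta> "act A" "act B" \<theta> \<theta>s
  for sA :: "'k::field \<Rightarrow> 'a::ring_1 \<Rightarrow> 'a"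
    and sV :: "'k \<Rightarrow> 'v::ab_group_add \<Rightarrow> 'v" (infixr \<open>*s\<close> 75)
    and act :: "'a \<Rightarrow> 'v \<Rightarrow> 'v"
    and d x \<xi> y \<eta> A B \<theta> \<theta>s +
  fixes E Es :: "nat \<Rightarrow> 'a"
  assumes E_act: "i \<le> d \<Longrightarrow> act (E i) w = \<xi> i w *s x i"
    and Es_act: "i \<le> d \<Longrightarrow> act (Es i) w = \<eta> i w *s y i"

lemma (in K_algebra_module) act_primitive_idempotent:
  assumes "act a w = sV t w"
  shows "act (primitive_idempotent d sA a \<theta> i) w =
    sV (\<Prod>j\<in>{0..d} - {i}. (t - \<theta> j) / (\<theta> i - \<theta> j)) w"
proof -
  have factor: "act (sA (1 / (\<theta> i - \<theta> j)) (a - sA (\<theta> j) 1)) w = sV ((t - \<theta> j) / (\<theta> i - \<theta> j)) w" for j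
    by (simp add: act_scale act_minus_left act_one assms V.scale_left_diff_distrib[symmetric])
  have "act (prod_list (map (\<lambda>j. sA (1 / (\<theta> i - \<theta> j)) (a - sA (\<theta> j) 1)) js)) w =
    sV (prod_list (map (\<lambda>j. (t - \<theta> j) / (\<theta> i - \<theta> j)) js)) w" for js
    by (induction js) (simp_all add: act_one act_mult factor act_scale_right mult.commute)
  moreover have "prod_list (map (\<lambda>j. (t - \<theta> j) / (\<theta> i - \<theta> j)) (filter (\<lambda>j. j \<noteq> i) [0..<d+1])) =
    (\<Prod>j\<in>{0..d} - {i}. (t - \<theta> j) / (\<theta> i - \<theta> j))"
    by (subst prod.distinct_set_conv_list[symmetric])
      (auto simp del: upt_Suc intro!: prod.cong)
  ultimately show ?thesis by (simp only: primitive_idempotent_def)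
qed

lemma (in K_algebra_module) act_primitive_idempotent_eigenvector:
  assumes "inj_on \<theta> {0..d}" "i \<le> d" "k \<le> d" "act a w = sV (\<theta> k) w"
  shows "act (primitive_idempotent d sA a \<theta> i) w = (if i = k then w else 0)"
proof (cases "i = k")
  case True
  have "(\<Prod>j\<in>{0..d} - {i}. (\<theta> k - \<theta> j) / (\<theta> i - \<theta> j)) = 1"
    using True assms(1-3) by (intro prod.neutral) (auto simp: inj_on_def)
  then show ?thesis using True act_primitive_idempotent[OF assms(4), of d \<theta> i] by simp
next
  case False
  have "(\<Prod>j\<in>{0..d} - {i}. (\<theta> k - \<theta> j) / (\<theta> i - \<theta> j)) = 0"
    using False assms(2,3) by (intro prod_zero) auto
  then show ?thesis using False act_primitive_idempotent[OF assms(4), of d \<theta> i] by simp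
qed

text \<open>The primitive idempotents separate the eigenvectors, which makes \<open>d + 1\<close> eigenvectors for
  distinct eigenvalues independent.\<close>

lemma (in matrix_module) eigenbasis_exists:
  assumes "idempotent_ordering d sA sV act a E \<theta>"
  shows "\<exists>x \<xi>. indexed_basis sV d x \<xi> \<and> (\<forall>i\<le>d. act a (x i) = sV (\<theta> i) (x i)) \<and>
    (\<forall>i\<le>d. \<forall>w. act (E i) w = sV (\<xi> i w) (x i))"
proof -
  have bij: "bij_betw \<theta> {0..d} (eigvals sV act a)"
    and E: "\<And>i. i \<le> d \<Longrightarrow> E i = primitive_idempotent d sA a \<theta> i"
    using assms by (auto simp: idempotent_ordering_def)
  have "\<exists>w. w \<noteq> 0 \<and> act a w = sV (\<theta> i) w" if "i \<le> d" for i
  proof -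
    have "\<theta> i \<in> eigvals sV act a" using bij that by (auto simp: bij_betw_def)
    then show ?thesis by (simp add: eigvals_def)
  qed
  then obtain x where x_nz: "\<And>i. i \<le> d \<Longrightarrow> x i \<noteq> 0"
    and x: "\<And>i. i \<le> d \<Longrightarrow> act a (x i) = sV (\<theta> i) (x i)" by metis
  have E_x: "act (E i) (x j) = (if i = j then x j else 0)" if "i \<le> d" "j \<le> d" for i j
    using act_primitive_idempotent_eigenvector[OF bij_betw_imp_inj_on[OF bij] that x[OF that(2)]]
    by (simp add: E that)
  have combination: "act (E k) (\<Sum>i\<le>d. sV (c i) (x i)) = sV (c k) (x k)" if "k \<le> d" for c k
    using that
    by (simp only: act_sum_right act_scale_right) (subst sum_eq_single_term[of k], auto simp: E_x)
  have indep: "c i = 0" if "(\<Sum>i\<le>d. sV (c i) (x i)) = 0" "i \<le> d" for c i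
    using combination[OF that(2), of c] that x_nz by (simp add: act_zero_right)
  obtain w \<omega> where "indexed_basis sV d w \<omega>" using has_basis by blast
  then interpret W: indexed_basis sV d w \<omega> .
  obtain \<xi> where "indexed_basis sV d x \<xi>"
    using V.indexed_basis_if_spanning_bound[of "w ` {..d}" d x] W.span_basis indep
      card_image_le[of "{..d}" w] by auto
  then interpret X: indexed_basis sV d x \<xi> .
  have "act (E i) w = sV (\<xi> i w) (x i)" if "i \<le> d" for i w
    by (subst X.expand[of w]) (rule combination[OF that])
  then show ?thesis using X.indexed_basis_axioms x by blast
qed

lemma (in matrix_module) Leonard_realization_exists:
  assumes "Leonard_system d sA sV act (A, E, B, Es)"
  shows "\<exists>x \<xi> y \<eta> \<theta> \<theta>s. Leonard_realization sA sV act d x \<xi> y \<eta> A B \<theta> \<theta>s E Es"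
proof -
  obtain \<theta> \<theta>s where \<theta>: "idempotent_ordering d sA sV act A E \<theta>"
    and \<theta>s: "idempotent_ordering d sA sV act B Es \<theta>s"
    using assms by (auto simp: Leonard_system_def)
  have B_zero: "\<And>i j. \<lbrakk>i \<le> d; j \<le> d; \<bar>int i - int j\<bar> > 1\<rbrakk> \<Longrightarrow> E i * B * E j = 0"
    and B_nz: "\<And>i j. \<lbrakk>i \<le> d; j \<le> d; \<bar>int i - int j\<bar> = 1\<rbrakk> \<Longrightarrow> E i * B * E j \<noteq> 0"
    and A_zero: "\<And>i j. \<lbrakk>i \<le> d; j \<le> d; \<bar>int i - int j\<bar> > 1\<rbrakk> \<Longrightarrow> Es i * A * Es j = 0"
    and A_nz: "\<And>i j. \<lbrakk>i \<le> d; j \<le> d; \<bar>int i - int j\<bar> = 1\<rbrakk> \<Longrightarrow> Es i * A * Es j \<noteq> 0"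
    using assms by (auto simp: Leonard_system_def)
  obtain x \<xi> where "indexed_basis sV d x \<xi>"
    and x: "\<forall>i\<le>d. act A (x i) = sV (\<theta> i) (x i)" and E: "\<forall>i\<le>d. \<forall>w. act (E i) w = sV (\<xi> i w) (x i)"
    using eigenbasis_exists[OF \<theta>] by blast
  then interpret X: indexed_basis sV d x \<xi> by simp
  obtain y \<eta> where "indexed_basis sV d y \<eta>"
    and y: "\<forall>i\<le>d. act B (y i) = sV (\<theta>s i) (y i)" and Es: "\<forall>i\<le>d. \<forall>w. act (Es i) w = sV (\<eta> i w) (y i)"
    using eigenbasis_exists[OF \<theta>s] by blast
  then interpret Y: indexed_basis sV d y \<eta> by simp
  interpret A: Vector_Spaces.linear sV sV "act A" by (rule act_linear)
  interpret B: Vector_Spaces.linear sV sV "act B" by (rule act_linear)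
  \<comment> \<open>$E_iA^*E_j$ maps \<open>x j\<close> to a multiple of \<open>x i\<close> and annihilates the other basis vectors;
    the multiple is the $(i,j)$-entry of $A^*$ in the basis \<open>x\<close>.\<close>
  have EBE: "E i * B * E j = 0 \<longleftrightarrow> \<xi> i (act B (x j)) = 0" if "i \<le> d" "j \<le> d" for i j
  proof -
    have *: "act (E i * B * E j) w = sV (\<xi> j w * \<xi> i (act B (x j))) (x i)" for w
      using that by (simp add: act_mult E act_scale_right X.coord_scale)
    show ?thesis
    proof
      assume "E i * B * E j = 0"
      then show "\<xi> i (act B (x j)) = 0"
        using *[of "x j"] that X.basis_nonzero[of i] by (simp add: act_zero_left X.coord_basis)
    next
      assume "\<xi> i (act B (x j)) = 0"
      then show "E i * B * E j = 0" by (intro faithful) (simp add: * act_zero_left)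
    qed
  qed
  have EAE: "Es i * A * Es j = 0 \<longleftrightarrow> \<eta> i (act A (y j)) = 0" if "i \<le> d" "j \<le> d" for i j
  proof -
    have *: "act (Es i * A * Es j) w = sV (\<eta> j w * \<eta> i (act A (y j))) (y i)" for w
      using that by (simp add: act_mult Es act_scale_right Y.coord_scale)
    show ?thesis
    proof
      assume "Es i * A * Es j = 0"
      then show "\<eta> i (act A (y j)) = 0"
        using *[of "y j"] that Y.basis_nonzero[of i] by (simp add: act_zero_left Y.coord_basis)
    next
      assume "\<eta> i (act A (y j)) = 0"
      then show "Es i * A * Es j = 0" by (intro faithful) (simp add: * act_zero_left)
    qed
  qed
  have inj: "inj_on \<theta> {..d}" "inj_on \<theta>s {..d}"
    using \<theta> \<theta>s by (auto simp: idempotent_ordering_def bij_betw_def atMost_atLeast0)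
  have "Leonard_realization sA sV act d x \<xi> y \<eta> A B \<theta> \<theta>s E Es"
  proof (unfold_locales, goal_cases)
    case (5 i j) then show ?case using EBE[of i j] B_zero[of i j] by auto
  next
    case (6 i j) then show ?case using EBE[of i j] B_nz[of i j] by auto
  next
    case (7 i j) then show ?case using EAE[of i j] A_zero[of i j] by auto
  next
    case (8 i j) then show ?case using EAE[of i j] A_nz[of i j] by auto
  qed (use inj x y E Es in auto)
  then show ?thesis by blast
qed

context Leonard_realization
begin

lemma dual_realization: "Leonard_realization sA sV act d y \<eta> x \<xi> B A \<theta>s \<theta> Es E"
proof -
  interpret D: Leonard_pair_bases sV d y \<eta> x \<xi> "act B" "act A" \<theta>s \<theta> by (rule dual)
  show ?thesis by unfold_locales (simp_all add: E_act Es_act)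
qed

lemma Down_realization:
  "Leonard_realization sA sV act d (\<lambda>i. x (d - i)) (\<lambda>i. \<xi> (d - i)) y \<eta> A B
     (\<lambda>i. \<theta> (d - i)) \<theta>s (\<lambda>i. E (d - i)) Es"
proof -
  interpret D: Leonard_pair_bases sV d "\<lambda>i. x (d - i)" "\<lambda>i. \<xi> (d - i)" y \<eta> "act A" "act B"
    "\<lambda>i. \<theta> (d - i)" \<theta>s by (rule reverse)
  show ?thesis by unfold_locales (simp_all add: E_act Es_act)
qed

lemma eigvals_A: "eigvals sV act A = \<theta> ` {0..d}"
proof (intro Set.set_eqI iffI)
  fix t assume "t \<in> \<theta> ` {0..d}"
  then obtain i where "i \<le> d" "t = \<theta> i" by auto
  then show "t \<in> eigvals sV act A"
    using A_x[of i] X.basis_nonzero[of i] unfolding eigvals_def by blast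
next
  fix t assume "t \<in> eigvals sV act A"
  then obtain w where w: "w \<noteq> 0" "act A w = t *s w" by (auto simp: eigvals_def)
  then obtain j where j: "j \<le> d" "\<xi> j w \<noteq> 0" using X.eq_zero_if_coords_zero by blast
  then have "\<theta> j = t" using coord_A[OF j(1), of w] w(2) by (simp add: X.coord_scale)
  then show "t \<in> \<theta> ` {0..d}" using j by auto
qed

text \<open>Two orderings of the eigenvalues with the same idempotents agree, because an eigenvector fixed
  by the \<open>i\<close>-th idempotent has the \<open>i\<close>-th eigenvalue of either ordering.\<close>

lemma assoc_eigval_A:
  assumes i: "i \<le> d" shows "assoc_eigval d sA sV act A E i = \<theta> i"
  unfolding assoc_eigval_def
proof (rule the_equality)
  have "E j = primitive_idempotent d sA A \<theta> j" if j: "j \<le> d" for j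
  proof (rule faithful, rule X.linear_eq_on_basis[OF act_linear act_linear])
    fix k assume k: "k \<le> d"
    have "inj_on \<theta> {0..d}" using inj_\<theta> by (simp add: atMost_atLeast0)
    from act_primitive_idempotent_eigenvector[OF this j k A_x[OF k]] j k
    show "act (E j) (x k) = act (primitive_idempotent d sA A \<theta> j) (x k)"
      by (simp add: E_act X.coord_basis)
  qed
  then have "idempotent_ordering d sA sV act A E \<theta>"
    using inj_\<theta> by (simp add: idempotent_ordering_def bij_betw_def eigvals_A atMost_atLeast0)
  then show "\<exists>\<theta>'. idempotent_ordering d sA sV act A E \<theta>' \<and> \<theta> i = \<theta>' i" by blast
next
  fix t assume "\<exists>\<theta>'. idempotent_ordering d sA sV act A E \<theta>' \<and> t = \<theta>' i"
  then obtain \<theta>' where bij: "bij_betw \<theta>' {0..d} (\<theta> ` {0..d})"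
    and E: "E i = primitive_idempotent d sA A \<theta>' i" and t: "t = \<theta>' i"
    using i by (auto simp: idempotent_ordering_def eigvals_A)
  then obtain k where k: "k \<le> d" "\<theta>' i = \<theta> k" using i by (fastforce simp: bij_betw_def)
  have "act (E i) (x k) = x k"
    using act_primitive_idempotent_eigenvector[OF bij_betw_imp_inj_on[OF bij] i i, of A "x k"] k
    by (simp add: E A_x)
  then show "t = \<theta> i"
    using i k t X.basis_nonzero[of k] by (auto simp: E_act X.coord_basis split: if_splits)
qed

lemma assoc_eigval_B: "i \<le> d \<Longrightarrow> assoc_eigval d sA sV act B Es i = \<theta>s i"
  by (rule Leonard_realization.assoc_eigval_A[OF dual_realization])

lemma mem_sum_E_iff:
  assumes J: "J \<subseteq> {0..d}"
  shows "w \<in> (\<Sum>j\<in>J. range (act (E j))) \<longleftrightarrow> (\<forall>j\<le>d. j \<notin> J \<longrightarrow> \<xi> j w = 0)"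
proof
  have fin: "finite J" using J finite_subset by blast
  assume "w \<in> (\<Sum>j\<in>J. range (act (E j)))"
  then obtain s where w: "w = sum s J" and s: "\<And>j. j \<in> J \<Longrightarrow> s j \<in> range (act (E j))"
    by (auto simp: set_sum_alt[OF fin])
  show "\<forall>j\<le>d. j \<notin> J \<longrightarrow> \<xi> j w = 0"
  proof (intro allI impI)
    fix j assume j: "j \<le> d" "j \<notin> J"
    have "\<xi> j (s k) = 0" if "k \<in> J" for k
      using s[OF that] that j J by (force simp: E_act X.coord_scale X.coord_basis)
    then show "\<xi> j w = 0" using j by (simp add: w X.coord_sum)
  qed
next
  have fin: "finite J" using J finite_subset by blast
  assume zero: "\<forall>j\<le>d. j \<notin> J \<longrightarrow> \<xi> j w = 0"
  have "w = (\<Sum>j\<in>{0..d}. act (E j) w)"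
    using X.expand[of w] by (simp add: E_act atMost_atLeast0)
  also have "\<dots> = (\<Sum>j\<in>J. act (E j) w)"
    by (rule sum.mono_neutral_right) (use J zero in \<open>auto simp: E_act\<close>)
  finally show "w \<in> (\<Sum>j\<in>J. range (act (E j)))"
    by (auto simp: set_sum_alt[OF fin])
qed

lemma split_component_iff:
  assumes "i \<le> d"
  shows "w \<in> split_component d act (A, E, B, Es) i \<longleftrightarrow>
    (\<forall>j\<le>d. i < j \<longrightarrow> \<eta> j w = 0) \<and> (\<forall>j\<le>d. j < i \<longrightarrow> \<xi> j w = 0)"
  using assms mem_sum_E_iff[of "{i..d}" w]
    Leonard_realization.mem_sum_E_iff[OF dual_realization, of "{0..i}" w]
  by (auto simp: split_component_def)

lemma split_component_eq_line:
  assumes "i \<le> d"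
  shows "split_component d act (A, E, B, Es) i = range (\<lambda>c. c *s u i)"
proof (intro Set.set_eqI iffI)
  fix w assume "w \<in> split_component d act (A, E, B, Es) i"
  then show "w \<in> range (\<lambda>c. c *s u i)"
    using split_component_line[of i w] assms by (auto simp: split_component_iff)
next
  fix w assume "w \<in> range (\<lambda>c. c *s u i)"
  then show "w \<in> split_component d act (A, E, B, Es) i"
    using assms by (auto simp: split_component_iff X.coord_scale Y.coord_scale coord_x_u_below coord_y_u_above)
qed

lemma first_split_eq:
  assumes "1 \<le> i" "i \<le> d"
  shows "first_split d sA sV act (A, E, B, Es) i = \<phi> i"
proof -
  let ?C = "(A - sA (assoc_eigval d sA sV act A E (i - 1)) 1) * (B - sA (assoc_eigval d sA sV act B Es i) 1)"
  have "act (B - sA (\<theta>s i) 1) (u i) = \<phi> i *s u (i - 1)"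
    using assms by (simp add: act_minus_left act_scale act_one B_u)
  moreover have "act (A - sA (\<theta> (i - 1)) 1) (u (i - 1)) = u i"
    using assms u_Suc[of "i - 1"] by (simp add: act_minus_left act_scale act_one)
  ultimately have C: "act ?C (u i) = \<phi> i *s u i"
    using assms by (simp add: act_mult assoc_eigval_A assoc_eigval_B act_scale_right)
  show ?thesis
    unfolding first_split_def prod.case Let_def
  proof (rule the_equality)
    show "\<exists>w\<in>split_component d act (A, E, B, Es) i. w \<noteq> 0 \<and> act ?C w = \<phi> i *s w"
      using C assms U.basis_nonzero[of i] V.scale_one[of "u i"]
      by (intro bexI[of _ "u i"]) (auto simp: split_component_eq_line intro: range_eqI[of _ _ 1])
  next
    fix c assume "\<exists>w\<in>split_component d act (A, E, B, Es) i. w \<noteq> 0 \<and> act ?C w = c *s w"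
    then obtain r where r: "r *s u i \<noteq> 0" "act ?C (r *s u i) = c *s r *s u i"
      using assms by (auto simp: split_component_eq_line)
    have "r *s \<phi> i *s u i = c *s r *s u i"
      using r(2) by (simp only: act_scale_right C)
    then show "c = \<phi> i" using r(1) by (simp add: mult.commute)
  qed
qed

lemma split_basis_u: "split_basis d sA sV act (A, E, B, Es) u"
  using U.inj_on_basis U.independent_basis U.span_basis
  by (auto simp: split_basis_def atMost_atLeast0 U.basis_nonzero split_component_eq_line
      assoc_eigval_A act_minus_left act_scale act_one u_Suc intro: range_eqI[of _ _ 1])

text \<open>The first vector lies on the line through \<open>u 0\<close>, and the recursion that it starts is linear.\<close>

lemma split_basis_multiple:
  assumes "split_basis d sA sV act (A, E, B, Es) w"
  shows "\<exists>c. c \<noteq> 0 \<and> (\<forall>i\<le>d. w i = c *s u i)"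
proof -
  have w0: "w 0 \<noteq> 0" "w 0 \<in> split_component d act (A, E, B, Es) 0"
    and step: "\<And>i. i < d \<Longrightarrow> act (A - sA (assoc_eigval d sA sV act A E i) 1) (w i) = w (i + 1)"
    using assms by (auto simp: split_basis_def)
  obtain c where c: "w 0 = c *s u 0"
    using w0(2) by (auto simp: split_component_eq_line)
  have "w i = c *s u i" if "i \<le> d" for i
    using that
  proof (induction i)
    case 0 show ?case by (rule c)
  next
    case (Suc i)
    then show ?case
      using step[of i]
      by (simp add: assoc_eigval_A act_minus_left act_scale act_one act_scale_right u_Suc
          V.scale_right_diff_distrib mult.commute)
  qed
  then show ?thesis using w0(1) c by auto
qed

text \<open>Passing to another split basis rescales all basis vectors by the same factor, which does not
  affect a projection; and the algebra contains exactly one element for each endomorphism.\<close>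

lemma split_idempotent_act:
  assumes k: "k \<le> d"
  shows "act (split_idempotent d sA sV act (A, E, B, Es) k) w = \<mu> k w *s u k"
proof -
  have lin: "Vector_Spaces.linear sV sV (\<lambda>w. \<mu> k w *s u k)"
    by unfold_locales (simp_all add: k U.coord_add U.coord_scale V.scale_left_distrib)
  then obtain a where a: "\<And>w. act a w = \<mu> k w *s u k" using full by blast
  have "split_idempotent d sA sV act (A, E, B, Es) k = a"
    unfolding split_idempotent_def
  proof (rule the_equality)
    show "\<exists>w. split_basis d sA sV act (A, E, B, Es) w \<and>
        (\<forall>j\<in>{0..d}. act a (w j) = (if j = k then w k else 0))"
      using split_basis_u k by (intro exI[of _ u]) (auto simp: a U.coord_basis)
  next
    fix b assume "\<exists>w. split_basis d sA sV act (A, E, B, Es) w \<and>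
        (\<forall>j\<in>{0..d}. act b (w j) = (if j = k then w k else 0))"
    then obtain w where w: "split_basis d sA sV act (A, E, B, Es) w"
      and b: "\<And>j. j \<le> d \<Longrightarrow> act b (w j) = (if j = k then w k else 0)" by auto
    obtain c where c: "c \<noteq> 0" "\<And>i. i \<le> d \<Longrightarrow> w i = c *s u i"
      using split_basis_multiple[OF w] by blast
    show "b = a"
    proof (rule faithful, rule U.linear_eq_on_basis[OF act_linear act_linear])
      fix j assume j: "j \<le> d"
      have "c *s act b (u j) = c *s act a (u j)"
        using b[OF j] j k c by (auto simp: act_scale_right a U.coord_basis)
      then show "act b (u j) = act a (u j)" using c(1) by simp
    qed
  qed
  then show ?thesis by (simp add: a)
qed

text \<open>This description refers to the split components only, so that idempotents of two systems whose
  components agree can be compared.\<close>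

lemma split_idempotent_eqI:
  assumes k: "k \<le> d"
    and a: "\<And>j w. \<lbrakk>j \<le> d; w \<in> split_component d act (A, E, B, Es) j\<rbrakk> \<Longrightarrow>
      act a w = (if j = k then w else 0)"
  shows "split_idempotent d sA sV act (A, E, B, Es) k = a"
proof (rule faithful, rule U.linear_eq_on_basis[OF act_linear act_linear])
  fix j assume j: "j \<le> d"
  have "u j \<in> split_component d act (A, E, B, Es) j"
    using j by (auto simp: split_component_eq_line intro: range_eqI[of _ _ 1])
  from a[OF j this] show "act (split_idempotent d sA sV act (A, E, B, Es) k) (u j) = act a (u j)"
    using j k by (auto simp: split_idempotent_act U.coord_basis)
qed

lemma tr_split_idempotent:
  assumes k: "k \<le> d"
  shows "tr sV act (C * split_idempotent d sA sV act (A, E, B, Es) k) = \<mu> k (act C (u k))"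
proof (rule tr_rank_one)
  show "Vector_Spaces.linear sV (*) (\<mu> k)"
    by unfold_locales (simp_all add: k U.coord_add U.coord_scale algebra_simps)
  show "act (C * split_idempotent d sA sV act (A, E, B, Es) k) w = \<mu> k w *s act C (u k)" for w
    using k by (simp add: act_mult split_idempotent_act act_scale_right)
qed

text \<open>The decompositions attached to $\Phi^{\downarrow}$ and to the dual of $\Phi^{\Downarrow}$ consist of
  the same lines in opposite order.\<close>

lemma split_idempotent_down:
  assumes k: "k \<le> d"
  shows "split_idempotent d sA sV act (A, E, B, \<lambda>i. Es (d - i)) k =
    split_idempotent d sA sV act (B, Es, A, \<lambda>i. E (d - i)) (d - k)"
proof -
  interpret R: Leonard_realization sA sV act d y \<eta> "\<lambda>i. x (d - i)" "\<lambda>i. \<xi> (d - i)" B A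
      \<theta>s "\<lambda>i. \<theta> (d - i)" Es "\<lambda>i. E (d - i)"
    by (rule Leonard_realization.dual_realization[OF Down_realization])
  interpret D: Leonard_realization sA sV act d x \<xi> "\<lambda>i. y (d - i)" "\<lambda>i. \<eta> (d - i)" A B
      \<theta> "\<lambda>i. \<theta>s (d - i)" E "\<lambda>i. Es (d - i)"
    by (rule Leonard_realization.dual_realization[OF
          Leonard_realization.Down_realization[OF dual_realization]])
  show ?thesis
  proof (rule D.split_idempotent_eqI[OF k])
    fix j w assume j: "j \<le> d" and "w \<in> split_component d act (A, E, B, \<lambda>i. Es (d - i)) j"
    then have w: "\<And>l. \<lbrakk>l \<le> d; j < l\<rbrakk> \<Longrightarrow> \<eta> (d - l) w = 0" "\<And>l. \<lbrakk>l \<le> d; l < j\<rbrakk> \<Longrightarrow> \<xi> l w = 0"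
      by (auto simp: D.split_component_iff)
    have "w \<in> split_component d act (B, Es, A, \<lambda>i. E (d - i)) (d - j)"
      unfolding R.split_component_iff[OF diff_le_self]
    proof (intro conjI allI impI)
      fix l assume l: "l \<le> d"
      { assume "d - j < l" then show "\<xi> (d - l) w = 0" using l j by (intro w(2)) auto }
      { assume "l < d - j" then show "\<eta> l w = 0" using l j w(1)[of "d - l"] by auto }
    qed
    then obtain c where c: "w = c *s R.u (d - j)"
      by (auto simp: R.split_component_eq_line)
    have "d - k = d - j \<longleftrightarrow> j = k" using j k by auto
    then show "act (split_idempotent d sA sV act (B, Es, A, \<lambda>i. E (d - i)) (d - k)) w =
        (if j = k then w else 0)"
      by (simp add: c R.split_idempotent_act act_scale_right R.U.coord_basis)
  qed
qed

lemma tr_commutator_split_idempotent: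
  assumes k: "k \<le> d"
  shows "tr sV act ((A * B - B * A) * split_idempotent d sA sV act (A, E, B, Es) k) = \<phi> k - \<phi> (Suc k)"
    and "tr sV act ((B * A - A * B) * split_idempotent d sA sV act (A, E, B, Es) k) = \<phi> (Suc k) - \<phi> k"
proof -
  show "tr sV act ((A * B - B * A) * split_idempotent d sA sV act (A, E, B, Es) k) = \<phi> k - \<phi> (Suc k)"
    using commutator_diagonal[OF k] by (simp add: tr_split_idempotent[OF k] act_minus_left act_mult)
  show "tr sV act ((B * A - A * B) * split_idempotent d sA sV act (A, E, B, Es) k) = \<phi> (Suc k) - \<phi> k"
    using commutator_diagonal[OF k] unfolding tr_split_idempotent[OF k]
    by (simp add: act_minus_left act_mult U.coord_diff[OF k] algebra_simps)
qed

text \<open>The traces telescope, and the boundary terms \<open>\<phi> 0\<close> and \<open>\<phi> (d + 1)\<close> are zero.\<close>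

lemma first_split_trace:
  assumes i: "1 \<le> i" "i \<le> d"
  defines "F \<equiv> split_idempotent d sA sV act (A, E, B, Es)"
  shows "first_split d sA sV act (A, E, B, Es) i = (\<Sum>k=i..d. tr sV act ((A * B - B * A) * F k))"
    and "first_split d sA sV act (A, E, B, Es) i = (\<Sum>k=0..i-1. tr sV act ((B * A - A * B) * F k))"
proof -
  have "(\<Sum>k=i..d. tr sV act ((A * B - B * A) * F k)) = (\<Sum>k=i..d. - (\<phi> (Suc k) - \<phi> k))"
    by (rule sum.cong) (simp_all add: F_def tr_commutator_split_idempotent)
  also have "\<dots> = \<phi> i"
    unfolding sum_negf using i by (subst sum_Suc_diff) (simp_all add: \<phi>_end)
  finally show "first_split d sA sV act (A, E, B, Es) i = (\<Sum>k=i..d. tr sV act ((A * B - B * A) * F k))"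
    using i by (simp add: first_split_eq)
  have "(\<Sum>k=0..i-1. tr sV act ((B * A - A * B) * F k)) = (\<Sum>k=0..i-1. \<phi> (Suc k) - \<phi> k)"
    by (rule sum.cong) (use i in \<open>simp_all add: F_def tr_commutator_split_idempotent\<close>)
  also have "\<dots> = \<phi> i"
    using i by (subst sum_Suc_diff) (simp_all add: \<phi>_def)
  finally show "first_split d sA sV act (A, E, B, Es) i = (\<Sum>k=0..i-1. tr sV act ((B * A - A * B) * F k))"
    using i by (simp add: first_split_eq)
qed

lemma first_split_dual:
  assumes "1 \<le> i" "i \<le> d"
  shows "first_split d sA sV act (B, Es, A, E) i = first_split d sA sV act (A, E, B, Es) i"
  using Leonard_realization.first_split_eq[OF dual_realization] assms
  by (simp add: first_split_eq dual_\<phi>)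

end

section \<open>Split sequences as traces\<close>

theorem theorem8p2:
  fixes d :: nat
    and sA :: "'k::field \<Rightarrow> 'a::ring_1 \<Rightarrow> 'a"
    and sV :: "'k \<Rightarrow> 'v::ab_group_add \<Rightarrow> 'v"
    and act :: "'a \<Rightarrow> 'v \<Rightarrow> 'v"
    and A As :: 'a
    and E Es :: "nat \<Rightarrow> 'a"
    and \<Phi> :: "'a system"
  assumes "K_algebra sA"
    and "isomorphic_to_Mat (d + 1) sA"
    and "simple_K_algebra_module sA sV act"
    and "\<Phi> = (A, E, As, Es)"
    and "Leonard_system d sA sV act \<Phi>"
  shows
    "let F = split_idempotent d sA sV act \<Phi>;
         F_dual = split_idempotent d sA sV act (dual \<Phi>);
         F_down = split_idempotent d sA sV act (down d \<Phi>);
         F_Down = split_idempotent d sA sV act (Down d \<Phi>)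
     in
      (\<forall>i\<in>{1..d}.
         first_split d sA sV act \<Phi> i = (\<Sum>k=i..d. tr sV act ((A * As - As * A) * F k)) \<and>
         first_split d sA sV act \<Phi> i = (\<Sum>k=0..i-1. tr sV act ((As * A - A * As) * F k)) \<and>
         first_split d sA sV act \<Phi> i = (\<Sum>k=0..i-1. tr sV act ((A * As - As * A) * F_dual k)) \<and>
         first_split d sA sV act \<Phi> i = (\<Sum>k=i..d. tr sV act ((As * A - A * As) * F_dual k))) \<and>
      (\<forall>i\<in>{1..d}.
         second_split d sA sV act \<Phi> i = (\<Sum>k=d-i+1..d. tr sV act ((A * As - As * A) * F_down k)) \<and>
         second_split d sA sV act \<Phi> i = (\<Sum>k=0..d-i. tr sV act ((As * A - A * As) * F_down k)) \<and>
         second_split d sA sV act \<Phi> i = (\<Sum>k=i..d. tr sV act ((A * As - As * A) * F_Down k)) \<and>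
         second_split d sA sV act \<Phi> i = (\<Sum>k=0..i-1. tr sV act ((As * A - A * As) * F_Down k)))"
proof -
  interpret simple_K_algebra_module sA sV act by fact
  interpret matrix_module sA sV act d by (rule matrix_module_if_isomorphic) fact
  obtain x \<xi> y \<eta> \<theta> \<theta>s where "Leonard_realization sA sV act d x \<xi> y \<eta> A As \<theta> \<theta>s E Es"
    using Leonard_realization_exists assms(4,5) by blast
  then interpret P: Leonard_realization sA sV act d x \<xi> y \<eta> A As \<theta> \<theta>s E Es .
  interpret P_dual: Leonard_realization sA sV act d y \<eta> x \<xi> As A \<theta>s \<theta> Es E
    by (rule P.dual_realization)
  interpret Q: Leonard_realization sA sV act d "\<lambda>i. x (d - i)" "\<lambda>i. \<xi> (d - i)" y \<eta> A As
      "\<lambda>i. \<theta> (d - i)" \<theta>s "\<lambda>i. E (d - i)" Es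
    by (rule P.Down_realization)
  interpret Q_dual: Leonard_realization sA sV act d y \<eta> "\<lambda>i. x (d - i)" "\<lambda>i. \<xi> (d - i)" As A
      \<theta>s "\<lambda>i. \<theta> (d - i)" Es "\<lambda>i. E (d - i)"
    by (rule Q.dual_realization)
  \<comment> \<open>Reversing the order of summation turns the first two sums for $\phi_i$ into the sums over the
    idempotents of the dual of $\Phi^{\Downarrow}$.\<close>
  let ?down = "split_idempotent d sA sV act (A, E, As, \<lambda>i. Es (d - i))"
  let ?Q_dual = "split_idempotent d sA sV act (As, Es, A, \<lambda>i. E (d - i))"
  have down: "(\<Sum>k=d-i+1..d. tr sV act (C * ?down k)) = (\<Sum>k=0..i-1. tr sV act (C * ?Q_dual k))"
      "(\<Sum>k=0..d-i. tr sV act (C * ?down k)) = (\<Sum>k=i..d. tr sV act (C * ?Q_dual k))"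
    if "i \<in> {1..d}" for i C
    by (rule sum.reindex_bij_witness[where i = "\<lambda>k. d - k" and j = "\<lambda>k. d - k"];
        use that P.split_idempotent_down in auto)+
  show ?thesis
    unfolding Let_def assms(4) dual_def down_def Down_def second_split_def prod.case
    using P.first_split_trace P_dual.first_split_trace P.first_split_dual
      Q.first_split_trace Q_dual.first_split_trace Q.first_split_dual down
    by simp
qed

end
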